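(* Let $n\ge1$. The ring $A_{fin}[\widetilde{Sp}(\mathbb{A}^1_n)]$ is the polynomial $\mathbb{R}$-algebra freely generated by the elements $p_{\mathbf a,\mathbf b}$ with $\mathbf a\in\mathbb{N}_+^n$ (i.e. $a_j\ge1$ for all $j$) and $\mathbf b\in\mathbb{N}^n$; that is, these elements are algebraically independent over $\mathbb{R}$ and generate $A_{fin}[\widetilde{Sp}(\mathbb{A}^1_n)]$ as an $\mathbb{R}$-algebra.
   Context: Fix $n\ge1$. For $m\ge1$ let $P_m=\mathbb{R}[x_{ij},y_{ij}]_{1\le i\le m,\,1\le j\le n}$, graded by total degree. $S_m$ acts on $P_m$ by permuting the block index $i$ simultaneously in the $x$ and $y$ variables; $A_m=P_m^{S_m}$. Let $\pi_m:A_{m+1}\to A_m$ set $x_{m+1,j}=y_{m+1,j}=0$. Let $A^\infty_{fin}=\varprojlim_m A_m$ in the category of graded rings (finite sums of compatible families $(f_m)$ of homogeneous elements of common degree). For a finite multiset $X=\{(\mathbf{x}_1,\mathbf{y}_1),\dots,(\mathbf{x}_r,\mathbf{y}_r)\}\subset\mathbb{R}^n\times\mathbb{R}^n$ and $f\in A^\infty_{fin}$, $\varphi_X(f)=f_m(\mathbf{x}_1,\mathbf{y}_1,\dots,\mathbf{x}_r,\mathbf{y}_r,0,\dots,0)$ for any $m\ge r$. A pair $(\mathbf z,\mathbf z')\in\mathbb{R}^n\times\mathbb{R}^n$ is degenerate if $z_j=z'_j$ for some $j$. $A_{fin}[\widetilde{Sp}(\mathbb{A}^1_n)]$ is the set of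 $f\in A^\infty_{fin}$ with $\varphi_{X\cup\{(\mathbf z,\mathbf z')\}}(f)=\varphi_X(f)$ for every finite multiset $X$ and every degenerate pair $(\mathbf z,\mathbf z')$. Write $\eta_{ij}=y_{ij}-x_{ij}$, $\xi_{ij}=y_{ij}+x_{ij}$. For $\mathbf a\in\mathbb{N}_+^n$, $\mathbf b\in\mathbb{N}^n$, $p_{\mathbf a,\mathbf b}\in A^\infty_{fin}$ is the compatible family $\big(\sum_{i=1}^m\prod_{j=1}^n\eta_{ij}^{a_j}\xi_{ij}^{b_j}\big)_{m\ge1}$, of degree $\sum_j(a_j+b_j)$. *)

theory Defs
  imports "HOL-Library.Poly_Mapping" "HOL-Combinatorics.Permutations" Complex_Main
begin

text \<open>Polynomials with real coefficients in variables of type 'v are represented as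
  elements of the monoid algebra (('v \<Rightarrow>0 nat) \<Rightarrow>0 real): a finitely supported map
  from monomials (finitely supported exponent vectors) to coefficients.
  Ring operations are those of Poly_Mapping (convolution product).\<close>

type_synonym 'v mpoly = "('v \<Rightarrow>\<^sub>0 nat) \<Rightarrow>\<^sub>0 real"

text \<open>Variables of P_m: (i, j, False) is x_ij and (i, j, True) is y_ij,
  with block index i in {1..m} and coordinate j in {1..n}.\<close>
type_synonym var = "nat \<times> nat \<times> bool"

definition mvars :: "'v mpoly \<Rightarrow> 'v set" where
  "mvars P = \<Union> (Poly_Mapping.keys ` Poly_Mapping.keys P)"

definition mvar :: "'v \<Rightarrow> 'v mpoly" where
  "mvar v = Poly_Mapping.single (Poly_Mapping.single v 1) 1"

definition mconst :: "real \<Rightarrow> 'v mpoly" where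
  "mconst c = Poly_Mapping.single 0 c"

definition mdeg :: "('v \<Rightarrow>\<^sub>0 nat) \<Rightarrow> nat" where
  "mdeg \<mu> = (\<Sum>v\<in>Poly_Mapping.keys \<mu>. Poly_Mapping.lookup \<mu> v)"

definition homogeneous :: "nat \<Rightarrow> 'v mpoly \<Rightarrow> bool" where
  "homogeneous d P \<longleftrightarrow> (\<forall>\<mu>\<in>Poly_Mapping.keys P. mdeg \<mu> = d)"

definition meval :: "'v mpoly \<Rightarrow> ('v \<Rightarrow> real) \<Rightarrow> real" where
  "meval P pt = (\<Sum>\<mu>\<in>Poly_Mapping.keys P. Poly_Mapping.lookup P \<mu> * (\<Prod>v\<in>Poly_Mapping.keys \<mu>. pt v ^ Poly_Mapping.lookup \<mu> v))"

definition Pring :: "nat \<Rightarrow> nat \<Rightarrow> var mpoly set" where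
  "Pring n m = {P. mvars P \<subseteq> {(i, j, s). 1 \<le> i \<and> i \<le> m \<and> 1 \<le> j \<and> j \<le> n}}"

definition ren :: "(nat \<Rightarrow> nat) \<Rightarrow> var \<Rightarrow> var" where
  "ren \<sigma> = (\<lambda>(i, j, s). (\<sigma> i, j, s))"

definition Aring :: "nat \<Rightarrow> nat \<Rightarrow> var mpoly set" where
  "Aring n m = {P \<in> Pring n m. \<forall>\<sigma>. \<sigma> permutes {1..m} \<longrightarrow>
       (\<forall>\<mu>. Poly_Mapping.lookup P (Poly_Mapping.map_key (ren \<sigma>) \<mu>) = Poly_Mapping.lookup P \<mu>)}"

text \<open>pi_m : A_{m+1} \<rightarrow> A_m, setting the variables of block m+1 to zero
  (i.e. deleting every monomial involving a variable of block m+1).\<close>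
definition zero_block :: "nat \<Rightarrow> var mpoly \<Rightarrow> var mpoly" where
  "zero_block k P = Abs_poly_mapping
     (\<lambda>\<mu>. if (\<exists>v\<in>Poly_Mapping.keys \<mu>. fst v = k) then 0 else Poly_Mapping.lookup P \<mu>)"

definition proj :: "nat \<Rightarrow> var mpoly \<Rightarrow> var mpoly" where
  "proj m P = zero_block (Suc m) P"

text \<open>Families (f_m)_m; m = 0 corresponds to P_0 = R (cofinal, harmless).\<close>
definition compatible :: "nat \<Rightarrow> (nat \<Rightarrow> var mpoly) \<Rightarrow> bool" where
  "compatible n f \<longleftrightarrow> (\<forall>m. f m \<in> Aring n m \<and> proj m (f (Suc m)) = f m)"

definition hom_family :: "nat \<Rightarrow> (nat \<Rightarrow> var mpoly) \<Rightarrow> bool" where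
  "hom_family n f \<longleftrightarrow> compatible n f \<and> (\<exists>d. \<forall>m. homogeneous d (f m))"

definition Afin :: "nat \<Rightarrow> (nat \<Rightarrow> var mpoly) set" where
  "Afin n = {f. \<exists>(K::nat set) g. finite K \<and> (\<forall>k\<in>K. hom_family n (g k)) \<and>
                  f = (\<lambda>m. \<Sum>k\<in>K. g k m)}"

text \<open>Evaluation phi_X; a finite multiset X is given by a list enumerating it,
  points (z, z') of R^n x R^n as pairs of functions on coordinates 1..n.\<close>
definition point :: "((nat \<Rightarrow> real) \<times> (nat \<Rightarrow> real)) list \<Rightarrow> var \<Rightarrow> real" where
  "point X = (\<lambda>(i, j, s). if 1 \<le> i \<and> i \<le> length X
                          then (if s then snd (X ! (i - 1)) j else fst (X ! (i - 1)) j)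
                          else 0)"

definition phi :: "((nat \<Rightarrow> real) \<times> (nat \<Rightarrow> real)) list \<Rightarrow> (nat \<Rightarrow> var mpoly) \<Rightarrow> real" where
  "phi X f = meval (f (length X)) (point X)"

definition degenerate :: "nat \<Rightarrow> (nat \<Rightarrow> real) \<times> (nat \<Rightarrow> real) \<Rightarrow> bool" where
  "degenerate n zz \<longleftrightarrow> (\<exists>j\<in>{1..n}. fst zz j = snd zz j)"

definition Asp :: "nat \<Rightarrow> (nat \<Rightarrow> var mpoly) set" where
  "Asp n = {f \<in> Afin n. \<forall>X zz. degenerate n zz \<longrightarrow> phi (X @ [zz]) f = phi X f}"

definition eta :: "nat \<Rightarrow> nat \<Rightarrow> var mpoly" where
  "eta i j = mvar (i, j, True) - mvar (i, j, False)"

definition xi :: "nat \<Rightarrow> nat \<Rightarrow> var mpoly" where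
  "xi i j = mvar (i, j, True) + mvar (i, j, False)"

text \<open>Multi-indices a, b are lists of length n; a ! (j-1) is a_j.\<close>
definition gen_index :: "nat \<Rightarrow> (nat list \<times> nat list) set" where
  "gen_index n = {(a, b). length a = n \<and> length b = n \<and> (\<forall>x\<in>set a. 0 < x)}"

definition pfam :: "nat \<Rightarrow> nat list \<times> nat list \<Rightarrow> nat \<Rightarrow> var mpoly" where
  "pfam n ab m = (\<Sum>i\<in>{1..m}. \<Prod>j\<in>{1..n}.
        eta i j ^ (fst ab ! (j - 1)) * xi i j ^ (snd ab ! (j - 1)))"

definition gen_eval :: "nat \<Rightarrow> (nat list \<times> nat list) mpoly \<Rightarrow> nat \<Rightarrow> var mpoly" where
  "gen_eval n Q m = (\<Sum>\<mu>\<in>Poly_Mapping.keys Q. mconst (Poly_Mapping.lookup Q \<mu>) *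
        (\<Prod>g\<in>Poly_Mapping.keys \<mu>. pfam n g m ^ Poly_Mapping.lookup \<mu> g))"

end

theory Submission
  imports Defs "HOL-Combinatorics.Multiset_Permutations"
begin

text \<open>Everything is done with polynomial functions, an element of the inverse limit being a
  function \<open>F\<close> of finite multisets of pairs.

  Generation: the Newton expansion writes \<open>F(X)\<close> as the sum over the subsets \<open>S\<close> of \<open>X\<close> of the
  iterated differences of \<open>F\<close> along \<open>S\<close>. Such a difference is a polynomial of bounded degree in
  the \<open>\<eta>, \<xi>\<close>-coordinates of the points of \<open>S\<close>. It vanishes as soon as one point is
  degenerate, so every monomial contains every \<open>\<eta>\<close>-coordinate; hence only boundedly large \<open>S\<close>
  contribute, and symmetrizing turns the expansion into a linear combination of sums of
  \<open>\<Prod>\<^sub>l \<phi>\<^sub>l(x\<^sub>i\<^sub>l)\<close> over tuples of distinct indices, where the \<open>\<phi>\<^sub>l\<close> are monomials with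
  exponents in the generating index set. As these monomials are closed under products, such sums
  are polynomials in the power sums.

  Independence: the power sums of a multiset are a combination of evaluations with natural
  coefficients. A polynomial relation therefore persists for real coefficients, and the
  monomials being linearly independent, real combinations of evaluations take arbitrary values
  on them.\<close>

abbreviation "keys \<equiv> Poly_Mapping.keys"
abbreviation "lookup \<equiv> Poly_Mapping.lookup"

section \<open>Evaluation of polynomials\<close>

definition monom_eval :: "('v \<Rightarrow>\<^sub>0 nat) \<Rightarrow> ('v \<Rightarrow> real) \<Rightarrow> real" where
  "monom_eval \<mu> pt = (\<Prod>v\<in>keys \<mu>. pt v ^ lookup \<mu> v)"

lemma monom_eval_superset:
  assumes "finite V" "keys \<mu> \<subseteq> V"
  shows "monom_eval \<mu> pt = (\<Prod>v\<in>V. pt v ^ lookup \<mu> v)"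
  unfolding monom_eval_def using assms
  by (intro prod.mono_neutral_left) (auto simp: in_keys_iff)

lemma monom_eval_0 [simp]: "monom_eval 0 pt = 1"
  by (simp add: monom_eval_def)

lemma monom_eval_add: "monom_eval (\<mu> + \<nu>) pt = monom_eval \<mu> pt * monom_eval \<nu> pt"
proof -
  let ?V = "keys \<mu> \<union> keys \<nu>"
  have "monom_eval (\<mu> + \<nu>) pt = (\<Prod>v\<in>?V. pt v ^ lookup (\<mu> + \<nu>) v)"
    by (rule monom_eval_superset) (simp_all add: keys_add)
  also have "\<dots> = (\<Prod>v\<in>?V. pt v ^ lookup \<mu> v) * (\<Prod>v\<in>?V. pt v ^ lookup \<nu> v)"
    by (simp add: lookup_add power_add prod.distrib)
  finally show ?thesis
    using monom_eval_superset[of ?V \<mu> pt] monom_eval_superset[of ?V \<nu> pt] by simp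
qed

lemma meval_eq: "meval P pt = (\<Sum>\<mu>\<in>keys P. lookup P \<mu> * monom_eval \<mu> pt)"
  by (simp add: meval_def monom_eval_def)

lemma meval_superset:
  assumes "finite S" "keys P \<subseteq> S"
  shows "meval P pt = (\<Sum>\<mu>\<in>S. lookup P \<mu> * monom_eval \<mu> pt)"
  unfolding meval_eq using assms
  by (intro sum.mono_neutral_left) (auto simp: in_keys_iff)

lemma meval_zero [simp]: "meval 0 pt = 0"
  by (simp add: meval_def)

lemma meval_single [simp]: "meval (Poly_Mapping.single \<mu> c) pt = c * monom_eval \<mu> pt"
  by (simp add: meval_eq)

lemma meval_add: "meval (P + Q) pt = meval P pt + meval Q pt"
proof -
  let ?S = "keys P \<union> keys Q"
  have "meval (P + Q) pt = (\<Sum>\<mu>\<in>?S. lookup (P + Q) \<mu> * monom_eval \<mu> pt)"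
    by (rule meval_superset) (simp_all add: keys_add)
  also have "\<dots> = (\<Sum>\<mu>\<in>?S. lookup P \<mu> * monom_eval \<mu> pt) + (\<Sum>\<mu>\<in>?S. lookup Q \<mu> * monom_eval \<mu> pt)"
    by (simp add: lookup_add algebra_simps sum.distrib)
  finally show ?thesis
    using meval_superset[of ?S P pt] meval_superset[of ?S Q pt] by simp
qed

lemma meval_uminus: "meval (- P) pt = - meval P pt"
  by (metis add.right_inverse add_eq_0_iff meval_add meval_zero)

lemma meval_diff: "meval (P - Q) pt = meval P pt - meval Q pt"
  by (metis diff_conv_add_uminus meval_add meval_uminus)

lemma meval_sum: "meval (\<Sum>i\<in>I. P i) pt = (\<Sum>i\<in>I. meval (P i) pt)"
  by (induction I rule: infinite_finite_induct) (auto simp: meval_add)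

lemma mpoly_eq_sum_single:
  fixes P :: "'a \<Rightarrow>\<^sub>0 'b :: comm_monoid_add"
  shows "P = (\<Sum>\<mu>\<in>keys P. Poly_Mapping.single \<mu> (lookup P \<mu>))"
proof (rule poly_mapping_eqI)
  fix \<nu>
  have "lookup (\<Sum>\<mu>\<in>keys P. Poly_Mapping.single \<mu> (lookup P \<mu>)) \<nu>
      = (\<Sum>\<mu>\<in>keys P. if \<mu> = \<nu> then lookup P \<mu> else 0)"
    by (simp add: lookup_sum lookup_single when_def)
  also have "\<dots> = lookup P \<nu>"
    by (simp add: in_keys_iff)
  finally show "lookup P \<nu> = lookup (\<Sum>\<mu>\<in>keys P. Poly_Mapping.single \<mu> (lookup P \<mu>)) \<nu>" ..
qed

lemma meval_mult: "meval (P * Q) pt = meval P pt * meval Q pt"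
proof -
  have "P * Q = (\<Sum>\<mu>\<in>keys P. Poly_Mapping.single \<mu> (lookup P \<mu>)) *
                (\<Sum>\<nu>\<in>keys Q. Poly_Mapping.single \<nu> (lookup Q \<nu>))"
    using mpoly_eq_sum_single[of P] mpoly_eq_sum_single[of Q] by simp
  also have "\<dots> = (\<Sum>\<mu>\<in>keys P. \<Sum>\<nu>\<in>keys Q. Poly_Mapping.single (\<mu> + \<nu>) (lookup P \<mu> * lookup Q \<nu>))"
    by (simp add: sum_product mult_single)
  finally have "meval (P * Q) pt = (\<Sum>\<mu>\<in>keys P. \<Sum>\<nu>\<in>keys Q.
      (lookup P \<mu> * monom_eval \<mu> pt) * (lookup Q \<nu> * monom_eval \<nu> pt))"
    by (simp add: meval_sum monom_eval_add mult_ac)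
  then show ?thesis
    by (simp add: meval_eq sum_product)
qed

lemma meval_one [simp]: "meval 1 pt = 1"
  using meval_single[of 0 1 pt] by simp

lemma meval_power: "meval (P ^ k) pt = meval P pt ^ k"
  by (induction k) (auto simp: meval_mult)

lemma meval_prod: "meval (\<Prod>i\<in>I. P i) pt = (\<Prod>i\<in>I. meval (P i) pt)"
  by (induction I rule: infinite_finite_induct) (auto simp: meval_mult)

lemma meval_mvar [simp]: "meval (mvar v) pt = pt v"
  by (simp add: mvar_def monom_eval_def)

lemma meval_mconst [simp]: "meval (mconst c) pt = c"
  by (simp add: mconst_def)

lemmas meval_simps = meval_add meval_diff meval_uminus meval_sum meval_mult meval_power meval_prod

lemma meval_cong:
  assumes "\<And>v. v \<in> mvars P \<Longrightarrow> pt v = pt' v"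
  shows "meval P pt = meval P pt'"
proof -
  have "pt v = pt' v" if "\<mu> \<in> keys P" "v \<in> keys \<mu>" for \<mu> v
    using assms[of v] that by (auto simp: mvars_def)
  then show ?thesis
    by (simp add: meval_eq monom_eval_def)
qed

lemma finite_mvars [simp]: "finite (mvars P)"
  by (simp add: mvars_def)

section \<open>Polynomials vanishing on a grid\<close>

lemma univariate_coeffs_zero:
  fixes c :: "nat \<Rightarrow> real"
  assumes "infinite A" "\<And>t. t \<in> A \<Longrightarrow> (\<Sum>i\<le>N. c i * t ^ i) = 0" "k \<le> N"
  shows "c k = 0"
proof (rule ccontr)
  assume "c k \<noteq> 0"
  then have "finite {z. (\<Sum>i\<le>N. c i * z ^ i) = 0}"
    using polyfun_roots_finite[of c k N] assms(3) by simp
  moreover have "A \<subseteq> {z. (\<Sum>i\<le>N. c i * z ^ i) = 0}"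
    using assms(2) by auto
  ultimately show False
    using assms(1) finite_subset by blast
qed

text \<open>Fix all variables but one, \<open>w\<close>: the sum becomes a univariate polynomial
  with infinitely many roots, so each of its coefficients vanishes. These coefficients are sums over
  the terms with equal \<open>w\<close>-exponent, and induction applies to them. Indexing by
  \<open>S\<close> with exponents \<open>E\<close> covers both exponent vectors and generator
  indices.\<close>

lemma monomials_independent:
  fixes E :: "'s \<Rightarrow> 'v \<Rightarrow> nat" and c :: "'s \<Rightarrow> real"
  assumes "finite V" "finite S" "infinite A"
    and sep: "\<And>s s'. s \<in> S \<Longrightarrow> s' \<in> S \<Longrightarrow> (\<And>v. v \<in> V \<Longrightarrow> E s v = E s' v) \<Longrightarrow> s = s'"
    and zero: "\<And>pt. (\<And>v. pt v \<in> A) \<Longrightarrow> (\<Sum>s\<in>S. c s * (\<Prod>v\<in>V. pt v ^ E s v)) = 0"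
    and "s \<in> S"
  shows "c s = 0"
  using assms(1,2,4,5,6)
proof (induction V arbitrary: S s rule: finite_induct)
  case empty
  then have "S = {s}" by blast
  moreover obtain a where "a \<in> A"
    using assms(3) infinite_imp_nonempty by blast
  ultimately show ?case
    using empty(3)[of "\<lambda>_. a"] by simp
next
  case (insert w V)
  \<comment> \<open>The terms sharing the \<open>w\<close>-exponent of \<open>s\<close> form one
    coefficient. Within this group the variables in \<open>V\<close> alone still separate the
    exponents.\<close>
  let ?S = "{s' \<in> S. E s' w = E s w}"
  let ?m = "\<lambda>pt s. c s * (\<Prod>v\<in>V. pt v ^ E s v)"
  define N where "N = Max ((\<lambda>s. E s w) ` S)"
  have N: "E s' w \<le> N" if "s' \<in> S" for s'
    unfolding N_def using insert.prems(1) that by (intro Max_ge) auto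
  have "(\<Sum>s'\<in>?S. ?m pt s') = 0" if pt: "\<And>v. pt v \<in> A" for pt
  proof -
    have "(\<Sum>i\<le>N. (\<Sum>s'\<in>{s' \<in> S. E s' w = i}. ?m pt s') * t ^ i) = 0" if "t \<in> A" for t
    proof -
      have neq: "v \<noteq> w" if "v \<in> V" for v
        using that insert.hyps by auto
      have "0 = (\<Sum>s'\<in>S. c s' * (\<Prod>v\<in>insert w V. (pt(w := t)) v ^ E s' v))"
        using insert.prems(3)[of "pt(w := t)"] pt \<open>t \<in> A\<close> by auto
      also have "\<dots> = (\<Sum>s'\<in>S. ?m pt s' * t ^ E s' w)"
        using insert.hyps neq by (intro sum.cong refl) (simp add: mult_ac)
      also have "\<dots> = (\<Sum>i\<le>N. \<Sum>s'\<in>{s' \<in> S. E s' w = i}. ?m pt s' * t ^ E s' w)"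
        using insert.prems(1) N by (intro sum.group[symmetric]) auto
      also have "\<dots> = (\<Sum>i\<le>N. (\<Sum>s'\<in>{s' \<in> S. E s' w = i}. ?m pt s') * t ^ i)"
        by (intro sum.cong refl) (simp add: sum_distrib_right)
      finally show ?thesis ..
    qed
    then show ?thesis
      using univariate_coeffs_zero[OF assms(3), where c = "\<lambda>i. \<Sum>s'\<in>{s' \<in> S. E s' w = i}. ?m pt s'"
          and N = N and k = "E s w"] N insert.prems(4) by blast
  qed
  then show ?case
  proof (intro insert.IH[of ?S s])
    show "s1 = s2" if "s1 \<in> ?S" "s2 \<in> ?S" "\<And>v. v \<in> V \<Longrightarrow> E s1 v = E s2 v" for s1 s2
      using that by (intro insert.prems(2)) auto
  qed (use insert.prems(1,4) in auto)
qed

text \<open>The grid \<open>A\<close> is kept general: all reals give equality of polynomials from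
  equality of values, while the natural numbers enter in the independence proof.\<close>

lemma meval_eq_0_imp:
  assumes "infinite A" "\<And>pt. (\<And>v. pt v \<in> A) \<Longrightarrow> meval P pt = 0"
  shows "P = 0"
proof -
  have "lookup P \<mu> = 0" if "\<mu> \<in> keys P" for \<mu>
  proof (rule monomials_independent[of "mvars P" "keys P" A "\<lambda>\<mu>. lookup \<mu>"])
    show "\<nu> = \<nu>'" if "\<nu> \<in> keys P" "\<nu>' \<in> keys P"
      "\<And>v. v \<in> mvars P \<Longrightarrow> lookup \<nu> v = lookup \<nu>' v" for \<nu> \<nu>'
    proof (rule poly_mapping_eqI)
      show "lookup \<nu> v = lookup \<nu>' v" for v
        using that by (cases "v \<in> mvars P") (auto simp: mvars_def in_keys_iff)
    qed
    show "(\<Sum>\<mu>\<in>keys P. lookup P \<mu> * (\<Prod>v\<in>mvars P. pt v ^ lookup \<mu> v)) = 0"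
      if "\<And>v. pt v \<in> A" for pt
    proof -
      have "monom_eval \<mu> pt = (\<Prod>v\<in>mvars P. pt v ^ lookup \<mu> v)" if "\<mu> \<in> keys P" for \<mu>
        using that by (intro monom_eval_superset) (auto simp: mvars_def)
      then show ?thesis
        using assms(2)[of pt] that by (simp add: meval_eq)
    qed
  qed (use assms that in auto)
  then show ?thesis
    by (metis in_keys_iff lookup_zero poly_mapping_eqI)
qed

lemma meval_inject:
  assumes "\<And>pt. meval P pt = meval Q pt"
  shows "P = Q"
proof -
  have "P - Q = 0"
    using assms by (intro meval_eq_0_imp[where A = UNIV]) (auto simp: infinite_UNIV_char_0 meval_diff)
  then show ?thesis by simp
qed

text \<open>Setting \<open>v\<close> to 0 kills exactly the monomials containing \<open>v\<close>.
  The others survive unchanged as distinct monomials in the remaining variables, so their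
  coefficients must be 0.\<close>

lemma keys_contain_var:
  assumes zero: "\<And>pt. pt v = 0 \<Longrightarrow> meval P pt = 0" and "\<mu> \<in> keys P"
  shows "v \<in> keys \<mu>"
proof (rule ccontr)
  assume v: "v \<notin> keys \<mu>"
  let ?S = "{\<nu> \<in> keys P. v \<notin> keys \<nu>}"
  let ?V = "mvars P - {v}"
  have "lookup P \<mu> = 0"
  proof (rule monomials_independent[of ?V ?S UNIV "\<lambda>\<mu>. lookup \<mu>"])
    show "\<nu> = \<nu>'" if "\<nu> \<in> ?S" "\<nu>' \<in> ?S"
      "\<And>u. u \<in> ?V \<Longrightarrow> lookup \<nu> u = lookup \<nu>' u" for \<nu> \<nu>'
    proof (rule poly_mapping_eqI)
      show "lookup \<nu> u = lookup \<nu>' u" for u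
        using that by (cases "u \<in> ?V") (auto simp: mvars_def in_keys_iff)
    qed
    show "(\<Sum>\<nu>\<in>?S. lookup P \<nu> * (\<Prod>u\<in>?V. pt u ^ lookup \<nu> u)) = 0" for pt
    proof -
      have "0 = meval P (pt(v := 0))"
        using zero by simp
      also have "\<dots> = (\<Sum>\<nu>\<in>?S. lookup P \<nu> * monom_eval \<nu> (pt(v := 0)))"
        unfolding meval_eq
        by (intro sum.mono_neutral_right)
          (auto simp: monom_eval_def in_keys_iff intro!: prod_zero bexI[of _ v])
      also have "\<dots> = (\<Sum>\<nu>\<in>?S. lookup P \<nu> * (\<Prod>u\<in>?V. pt u ^ lookup \<nu> u))"
      proof (intro sum.cong refl arg_cong2[where f = "(*)"])
        fix \<nu> assume \<nu>: "\<nu> \<in> ?S"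
        then have "monom_eval \<nu> (pt(v := 0)) = (\<Prod>u\<in>?V. (pt(v := 0)) u ^ lookup \<nu> u)"
          by (intro monom_eval_superset) (auto simp: mvars_def)
        then show "monom_eval \<nu> (pt(v := 0)) = (\<Prod>u\<in>?V. pt u ^ lookup \<nu> u)"
          by simp
      qed
      finally show ?thesis ..
    qed
  qed (use assms v in \<open>auto simp: infinite_UNIV_char_0\<close>)
  then show False
    using assms(2) by (simp add: in_keys_iff)
qed

section \<open>Variables and degrees\<close>

lemma mvars_add: "mvars (P + Q) \<subseteq> mvars P \<union> mvars Q"
  using keys_add[of P Q] by (auto simp: mvars_def)

lemma mvars_uminus [simp]: "mvars (- P) = mvars (P :: 'v mpoly)"
  by (auto simp: mvars_def in_keys_iff)

lemma mvars_diff: "mvars (P - Q) \<subseteq> mvars P \<union> mvars (Q :: 'v mpoly)"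
  using mvars_add[of P "- Q"] by simp

lemma mvars_mult: "mvars (P * Q) \<subseteq> mvars P \<union> mvars Q"
proof
  fix v assume "v \<in> mvars (P * Q)"
  then obtain \<mu> where \<mu>: "\<mu> \<in> keys (P * Q)" "v \<in> keys \<mu>"
    by (auto simp: mvars_def)
  then obtain a b where "\<mu> = a + b" "a \<in> keys P" "b \<in> keys Q"
    using keys_mult[of P Q] by blast
  then show "v \<in> mvars P \<union> mvars Q"
    using \<mu>(2) keys_add[of a b] by (auto simp: mvars_def)
qed

lemma mvars_zero [simp]: "mvars 0 = {}"
  by (simp add: mvars_def)

lemma mvars_one [simp]: "mvars 1 = {}"
  by (simp add: mvars_def)

lemma mvars_mconst [simp]: "mvars (mconst c) = {}"
  by (simp add: mvars_def mconst_def)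

lemma mvars_mvar [simp]: "mvars (mvar v) = {v}"
  by (simp add: mvars_def mvar_def)

lemma mvars_sum: "mvars (\<Sum>i\<in>I. P i) \<subseteq> (\<Union>i\<in>I. mvars (P i))"
proof (induction I rule: infinite_finite_induct)
  case (insert i I)
  then show ?case using mvars_add[of "P i" "sum P I"] by auto
qed auto

lemma mvars_prod: "mvars (\<Prod>i\<in>I. P i) \<subseteq> (\<Union>i\<in>I. mvars (P i))"
proof (induction I rule: infinite_finite_induct)
  case (insert i I)
  then show ?case using mvars_mult[of "P i" "prod P I"] by auto
qed auto

lemma mvars_power: "mvars (P ^ k) \<subseteq> mvars P"
  using mvars_mult[of P] by (induction k) fastforce+

section \<open>Degrees and homogeneity\<close>

lemma mdeg_superset:
  assumes "finite V" "keys \<mu> \<subseteq> V"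
  shows "mdeg \<mu> = (\<Sum>v\<in>V. lookup \<mu> v)"
  unfolding mdeg_def using assms by (intro sum.mono_neutral_left) (auto simp: in_keys_iff)

lemma mdeg_add: "mdeg (\<mu> + \<nu>) = mdeg \<mu> + mdeg \<nu>"
proof -
  let ?V = "keys \<mu> \<union> keys \<nu>"
  have "mdeg (\<mu> + \<nu>) = (\<Sum>v\<in>?V. lookup (\<mu> + \<nu>) v)"
    by (rule mdeg_superset) (simp_all add: keys_add)
  then show ?thesis
    using mdeg_superset[of ?V \<mu>] mdeg_superset[of ?V \<nu>] by (simp add: lookup_add sum.distrib)
qed

lemma mdeg_zero [simp]: "mdeg 0 = 0"
  by (simp add: mdeg_def)

lemma card_keys_le_mdeg: "card (keys \<mu>) \<le> mdeg \<mu>"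
proof -
  have "(\<Sum>v\<in>keys \<mu>. 1) \<le> (\<Sum>v\<in>keys \<mu>. lookup \<mu> v)"
    by (intro sum_mono) (auto simp: in_keys_iff Suc_le_eq)
  then show ?thesis
    by (simp add: mdeg_def)
qed

lemma homogeneous_mvar: "homogeneous 1 (mvar v)"
  by (auto simp: homogeneous_def mvar_def mdeg_def)

lemma homogeneous_mconst: "homogeneous 0 (mconst c)"
  by (auto simp: homogeneous_def mconst_def)

lemma homogeneous_one: "homogeneous 0 1"
  by (auto simp: homogeneous_def)

lemma homogeneous_zero: "homogeneous d 0"
  by (auto simp: homogeneous_def)

lemma homogeneous_add: "homogeneous d P \<Longrightarrow> homogeneous d Q \<Longrightarrow> homogeneous d (P + Q)"
  using keys_add[of P Q] by (auto simp: homogeneous_def)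

lemma homogeneous_diff:
  fixes P Q :: "'v mpoly"
  shows "homogeneous d P \<Longrightarrow> homogeneous d Q \<Longrightarrow> homogeneous d (P - Q)"
  using homogeneous_add[of d P "- Q"] by (auto simp: homogeneous_def in_keys_iff)

lemma homogeneous_mult:
  "homogeneous d P \<Longrightarrow> homogeneous e Q \<Longrightarrow> homogeneous (d + e) (P * Q)"
  using keys_mult[of P Q] by (fastforce simp: homogeneous_def mdeg_add)

lemma homogeneous_sum:
  "(\<And>i. i \<in> I \<Longrightarrow> homogeneous d (P i)) \<Longrightarrow> homogeneous d (\<Sum>i\<in>I. P i)"
  by (induction I rule: infinite_finite_induct) (auto simp: homogeneous_zero homogeneous_add)

lemma homogeneous_prod:
  "(\<And>i. i \<in> I \<Longrightarrow> homogeneous (d i) (P i)) \<Longrightarrow> homogeneous (\<Sum>i\<in>I. d i) (\<Prod>i\<in>I. P i)"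
  by (induction I rule: infinite_finite_induct) (auto simp: homogeneous_one homogeneous_mult)

lemma homogeneous_power: "homogeneous d P \<Longrightarrow> homogeneous (k * d) (P ^ k)"
  by (induction k) (auto simp: homogeneous_one homogeneous_mult)

section \<open>Polynomial functions\<close>

text \<open>Hiding the polynomial behind its function lets variables and degree be bounded through
  differences and substitutions without computing a witness.\<close>

definition polyfun :: "'v set \<Rightarrow> nat \<Rightarrow> (('v \<Rightarrow> real) \<Rightarrow> real) \<Rightarrow> bool" where
  "polyfun V d h \<longleftrightarrow> (\<exists>P. mvars P \<subseteq> V \<and> (\<forall>\<mu>\<in>keys P. mdeg \<mu> \<le> d) \<and> (\<forall>pt. h pt = meval P pt))"

lemma polyfun_const: "polyfun V d (\<lambda>_. c)"
  unfolding polyfun_def by (rule exI[of _ "mconst c"]) (auto simp: mconst_def mvars_def monom_eval_def)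

lemma polyfun_var: "v \<in> V \<Longrightarrow> polyfun V 1 (\<lambda>pt. pt v)"
  unfolding polyfun_def
  by (rule exI[of _ "mvar v"]) (use homogeneous_mvar[of v] in \<open>auto simp: homogeneous_def\<close>)

lemma polyfun_add: "polyfun V d h \<Longrightarrow> polyfun V d k \<Longrightarrow> polyfun V d (\<lambda>pt. h pt + k pt)"
  unfolding polyfun_def
proof clarify
  fix P Q :: "'a mpoly"
  assume "mvars P \<subseteq> V" "\<forall>\<mu>\<in>keys P. mdeg \<mu> \<le> d" "\<forall>pt. h pt = meval P pt"
    "mvars Q \<subseteq> V" "\<forall>\<mu>\<in>keys Q. mdeg \<mu> \<le> d" "\<forall>pt. k pt = meval Q pt"
  then show "\<exists>P. mvars P \<subseteq> V \<and> (\<forall>\<mu>\<in>keys P. mdeg \<mu> \<le> d) \<and> (\<forall>pt. h pt + k pt = meval P pt)"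
    using mvars_add[of P Q] keys_add[of P Q]
    by (intro exI[of _ "P + Q"]) (auto simp: meval_add)
qed

lemma polyfun_mult: "polyfun V d h \<Longrightarrow> polyfun V e k \<Longrightarrow> polyfun V (d + e) (\<lambda>pt. h pt * k pt)"
  unfolding polyfun_def
proof clarify
  fix P Q :: "'a mpoly"
  assume A: "mvars P \<subseteq> V" "\<forall>\<mu>\<in>keys P. mdeg \<mu> \<le> d" "\<forall>pt. h pt = meval P pt"
    "mvars Q \<subseteq> V" "\<forall>\<mu>\<in>keys Q. mdeg \<mu> \<le> e" "\<forall>pt. k pt = meval Q pt"
  have "mdeg \<mu> \<le> d + e" if \<mu>: "\<mu> \<in> keys (P * Q)" for \<mu>
  proof -
    obtain a b where "\<mu> = a + b" "a \<in> keys P" "b \<in> keys Q"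
      using keys_mult[of P Q] \<mu> by blast
    then show ?thesis
      using A(2,5) by (simp add: mdeg_add add_mono)
  qed
  then show "\<exists>P. mvars P \<subseteq> V \<and> (\<forall>\<mu>\<in>keys P. mdeg \<mu> \<le> d + e) \<and> (\<forall>pt. h pt * k pt = meval P pt)"
    using A mvars_mult[of P Q] by (intro exI[of _ "P * Q"]) (auto simp: meval_mult)
qed

lemma polyfun_cmult: "polyfun V d h \<Longrightarrow> polyfun V d (\<lambda>pt. c * h pt)"
  using polyfun_mult[OF polyfun_const[of V 0 c]] by simp

lemma polyfun_diff: "polyfun V d h \<Longrightarrow> polyfun V d k \<Longrightarrow> polyfun V d (\<lambda>pt. h pt - k pt)"
  using polyfun_add[of V d h "\<lambda>pt. (- 1) * k pt"] polyfun_cmult[of V d k "- 1"] by simp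

lemma polyfun_mono: "polyfun V d h \<Longrightarrow> d \<le> e \<Longrightarrow> polyfun V e h"
  unfolding polyfun_def by (meson order_trans)

lemma polyfun_sum:
  "(\<And>i. i \<in> I \<Longrightarrow> polyfun V d (h i)) \<Longrightarrow> polyfun V d (\<lambda>pt. \<Sum>i\<in>I. h i pt)"
  by (induction I rule: infinite_finite_induct) (auto intro: polyfun_const polyfun_add)

lemma polyfun_power: "polyfun V d h \<Longrightarrow> polyfun V (k * d) (\<lambda>pt. h pt ^ k)"
  by (induction k) (auto intro: polyfun_const polyfun_mult)

lemma polyfun_prod:
  "(\<And>i. i \<in> I \<Longrightarrow> polyfun V (d i) (h i)) \<Longrightarrow> polyfun V (\<Sum>i\<in>I. d i) (\<lambda>pt. \<Prod>i\<in>I. h i pt)"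
  by (induction I rule: infinite_finite_induct) (auto intro: polyfun_const polyfun_mult)

text \<open>Substituting functions of degree at most 1 sends a monomial to a product of as many such
  functions as its degree, so the bound \<open>d\<close> survives.\<close>

lemma polyfun_compose_linear:
  assumes "\<And>v. v \<in> mvars P \<Longrightarrow> polyfun V 1 (\<lambda>pt. \<theta> pt v)" and "\<And>\<mu>. \<mu> \<in> keys P \<Longrightarrow> mdeg \<mu> \<le> d"
  shows "polyfun V d (\<lambda>pt. meval P (\<theta> pt))"
  unfolding meval_eq
proof (intro polyfun_sum polyfun_cmult)
  fix \<mu> assume \<mu>: "\<mu> \<in> keys P"
  have "polyfun V (\<Sum>v\<in>keys \<mu>. lookup \<mu> v * 1) (\<lambda>pt. \<Prod>v\<in>keys \<mu>. \<theta> pt v ^ lookup \<mu> v)"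
    using \<mu> by (intro polyfun_prod polyfun_power assms) (auto simp: mvars_def)
  then have "polyfun V (mdeg \<mu>) (\<lambda>pt. monom_eval \<mu> (\<theta> pt))"
    unfolding monom_eval_def mdeg_def by simp
  then show "polyfun V d (\<lambda>pt. monom_eval \<mu> (\<theta> pt))"
    using assms(2)[OF \<mu>] by (rule polyfun_mono)
qed

section \<open>The generators as functions\<close>

type_synonym pair = "(nat \<Rightarrow> real) \<times> (nat \<Rightarrow> real)"

definition pair_monom :: "nat \<Rightarrow> nat list \<times> nat list \<Rightarrow> pair \<Rightarrow> real" where
  "pair_monom n g z = (\<Prod>j\<in>{1..n}.
     (snd z j - fst z j) ^ (fst g ! (j - 1)) * (snd z j + fst z j) ^ (snd g ! (j - 1)))"

definition block_pair :: "(var \<Rightarrow> real) \<Rightarrow> nat \<Rightarrow> pair" where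
  "block_pair pt i = (\<lambda>j. pt (i, j, False), \<lambda>j. pt (i, j, True))"

definition psum :: "nat \<Rightarrow> pair list \<Rightarrow> nat list \<times> nat list \<Rightarrow> real" where
  "psum n X g = (\<Sum>l<length X. pair_monom n g (X ! l))"

definition block_vars :: "nat \<Rightarrow> nat \<Rightarrow> var set" where
  "block_vars n m = {1..m} \<times> {1..n} \<times> UNIV"

lemma Pring_iff: "P \<in> Pring n m \<longleftrightarrow> mvars P \<subseteq> block_vars n m"
  by (auto simp: Pring_def block_vars_def)

text \<open>This is where positivity of the exponents a_j enters: at a coordinate with z_j = z'_j
  the factor \<eta>_j occurs to a positive power.\<close>

lemma pair_monom_degenerate:
  assumes "degenerate n z" "g \<in> gen_index n"
  shows "pair_monom n g z = 0"
proof -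
  obtain j where j: "j \<in> {1..n}" "fst z j = snd z j"
    using assms(1) by (auto simp: degenerate_def)
  have "fst g ! (j - 1) \<in> set (fst g)"
    using j assms(2) by (intro nth_mem) (auto simp: gen_index_def)
  then have "fst g ! (j - 1) > 0"
    using assms(2) by (auto simp: gen_index_def)
  then show ?thesis
    unfolding pair_monom_def using j by (intro prod_zero bexI[of _ j]) auto
qed

lemma meval_pfam: "meval (pfam n g m) pt = (\<Sum>i\<in>{1..m}. pair_monom n g (block_pair pt i))"
  by (simp add: pfam_def pair_monom_def block_pair_def eta_def xi_def meval_simps)

lemma meval_gen_eval:
  "meval (gen_eval n Q m) pt = meval Q (\<lambda>g. \<Sum>i\<in>{1..m}. pair_monom n g (block_pair pt i))"
  by (simp add: gen_eval_def meval_simps meval_pfam) (simp add: meval_def)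

lemma block_pair_point:
  assumes "l < length X"
  shows "block_pair (point X) (Suc l) = X ! l"
  using assms by (auto simp: block_pair_def point_def)

text \<open>This bridges the inverse limit and functions on lists of points: both independence and
  generation are decided on the right-hand side.\<close>

lemma phi_gen_eval: "phi X (gen_eval n Q) = meval Q (psum n X)"
proof -
  have "(\<Sum>i\<in>{1..length X}. pair_monom n g (block_pair (point X) i)) = psum n X g" for g
    unfolding psum_def
    by (simp add: sum.atLeast1_atMost_eq block_pair_point)
  then show ?thesis
    by (simp add: phi_def meval_gen_eval)
qed

lemma gen_eval_Pring: "gen_eval n Q m \<in> Pring n m"
proof -
  have "mvars (eta i j) \<subseteq> block_vars n m" "mvars (xi i j) \<subseteq> block_vars n m"
    if "i \<in> {1..m}" "j \<in> {1..n}" for i j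
    using that mvars_diff[of "mvar (i, j, True)" "mvar (i, j, False)"]
      mvars_add[of "mvar (i, j, True)" "mvar (i, j, False)"]
    by (auto simp: eta_def xi_def block_vars_def)
  then have "mvars (pfam n g m) \<subseteq> block_vars n m" for g
    unfolding pfam_def
    by (intro order_trans[OF mvars_sum] UN_least order_trans[OF mvars_prod] order_trans[OF mvars_mult]
        Un_least order_trans[OF mvars_power])
  then show ?thesis
    unfolding Pring_iff gen_eval_def
    by (intro order_trans[OF mvars_sum] UN_least order_trans[OF mvars_mult] Un_least
        order_trans[OF mvars_prod] order_trans[OF mvars_power]) auto
qed

section \<open>Symmetric polynomials and compatible families\<close>

lemma monom_eval_map_key:
  assumes "bij r"
  shows "monom_eval (Poly_Mapping.map_key r \<mu>) (pt \<circ> r) = monom_eval \<mu> pt"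
proof -
  have inj: "inj r" and surj: "surj r"
    using assms by (auto simp: bij_def)
  have "monom_eval \<mu> pt = (\<Prod>v\<in>r ` (r -` keys \<mu>). pt v ^ lookup \<mu> v)"
    using surj by (simp add: monom_eval_def surj_image_vimage_eq)
  also have "\<dots> = (\<Prod>u\<in>r -` keys \<mu>. pt (r u) ^ lookup \<mu> (r u))"
    using inj by (subst prod.reindex) (auto intro: inj_on_subset)
  finally show ?thesis
    using inj by (simp add: monom_eval_def keys_map_key map_key.rep_eq)
qed

lemma bij_map_key:
  fixes r :: "'a \<Rightarrow> 'a"
  assumes "bij r"
  shows "bij (Poly_Mapping.map_key r :: ('a \<Rightarrow>\<^sub>0 nat) \<Rightarrow> _)"
proof (rule bij_betw_byWitness[where f' = "Poly_Mapping.map_key (inv r)"])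
  have "inj r" "inj (inv r)"
    using assms by (auto simp: bij_def inj_imp_surj_inv surj_imp_inj_inv)
  then show "\<forall>a\<in>UNIV. Poly_Mapping.map_key (inv r) (Poly_Mapping.map_key r a) = (a :: 'a \<Rightarrow>\<^sub>0 nat)"
    "\<forall>a\<in>UNIV. Poly_Mapping.map_key r (Poly_Mapping.map_key (inv r) a) = (a :: 'a \<Rightarrow>\<^sub>0 nat)"
    using assms
    by (auto intro!: poly_mapping_eqI simp: map_key.rep_eq bij_is_surj surj_f_inv_f bij_is_inj)
qed auto

lemma meval_map_key:
  fixes r :: "'a \<Rightarrow> 'a"
  assumes "bij r"
  shows "meval (Poly_Mapping.map_key (Poly_Mapping.map_key r) P) pt = meval P (pt \<circ> r)"
proof -
  let ?k = "Poly_Mapping.map_key r :: ('a \<Rightarrow>\<^sub>0 nat) \<Rightarrow> _"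
  have inj: "inj ?k" and surj: "surj ?k"
    using bij_map_key[OF assms] by (auto simp: bij_def)
  have "meval P (pt \<circ> r) = (\<Sum>\<mu>\<in>?k ` (?k -` keys P). lookup P \<mu> * monom_eval \<mu> (pt \<circ> r))"
    using surj by (simp add: meval_eq surj_image_vimage_eq)
  also have "\<dots> = (\<Sum>\<mu>\<in>?k -` keys P. lookup P (?k \<mu>) * monom_eval (?k \<mu>) (pt \<circ> r))"
    using inj by (subst sum.reindex) (auto intro: inj_on_subset)
  also have "\<dots> = meval (Poly_Mapping.map_key ?k P) pt"
    using inj by (simp add: meval_eq keys_map_key map_key.rep_eq monom_eval_map_key[OF assms])
  finally show ?thesis ..
qed

lemma bij_ren:
  assumes "bij \<sigma>"
  shows "bij (ren \<sigma>)"
proof (rule bij_betw_byWitness[where f' = "ren (inv \<sigma>)"])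
  show "\<forall>a\<in>UNIV. ren (inv \<sigma>) (ren \<sigma> a) = a" "\<forall>a\<in>UNIV. ren \<sigma> (ren (inv \<sigma>) a) = a"
    using assms by (auto simp: ren_def bij_is_inj bij_is_surj surj_f_inv_f)
qed auto

text \<open>Permuting exponent vectors amounts to permuting the arguments, and a real polynomial is
  determined by its values. Symmetry can therefore be checked on values instead of
  coefficients.\<close>

lemma Aring_iff:
  "P \<in> Aring n m \<longleftrightarrow> P \<in> Pring n m \<and>
     (\<forall>\<sigma> pt. \<sigma> permutes {1..m} \<longrightarrow> meval P (pt \<circ> ren \<sigma>) = meval P pt)"
proof -
  have "(\<forall>\<mu>. lookup P (Poly_Mapping.map_key (ren \<sigma>) \<mu>) = lookup P \<mu>) \<longleftrightarrow>
        (\<forall>pt. meval P (pt \<circ> ren \<sigma>) = meval P pt)" (is "?L \<longleftrightarrow> ?R") if "\<sigma> permutes {1..m}" for \<sigma>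
  proof -
    have b: "bij (ren \<sigma>)"
      using that by (intro bij_ren) (rule permutes_bij)
    let ?P = "Poly_Mapping.map_key (Poly_Mapping.map_key (ren \<sigma>)) P"
    have "?L \<longleftrightarrow> ?P = P"
      using bij_map_key[OF b] by (simp add: poly_mapping_eq_iff fun_eq_iff map_key.rep_eq bij_is_inj)
    also have "\<dots> \<longleftrightarrow> (\<forall>pt. meval ?P pt = meval P pt)"
      using meval_inject by metis
    finally show ?thesis
      by (simp add: meval_map_key[OF b])
  qed
  then show ?thesis
    by (auto simp: Aring_def)
qed

lemma meval_zero_block: "meval (zero_block k P) pt = meval P (\<lambda>v. if fst v = k then 0 else pt v)"
proof -
  let ?c = "\<lambda>\<mu>. if (\<exists>v\<in>keys \<mu>. fst v = k) then 0 else lookup P \<mu>"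
  \<comment> \<open>Finite support is what makes \<open>Abs_poly_mapping\<close> in
    \<open>zero_block\<close> return the intended coefficients.\<close>
  have "finite {\<mu>. ?c \<mu> \<noteq> 0}"
    by (rule finite_subset[OF _ finite_keys[of P]]) (auto simp: in_keys_iff split: if_splits)
  then have lookup: "lookup (zero_block k P) = ?c"
    by (simp add: zero_block_def)
  have "meval (zero_block k P) pt = (\<Sum>\<mu>\<in>keys P. lookup (zero_block k P) \<mu> * monom_eval \<mu> pt)"
    by (rule meval_superset) (auto simp: in_keys_iff lookup split: if_splits)
  also have "\<dots> = (\<Sum>\<mu>\<in>keys P. ?c \<mu> * monom_eval \<mu> pt)"
    by (simp add: lookup)
  also have "\<dots> = (\<Sum>\<mu>\<in>keys P. lookup P \<mu> * monom_eval \<mu> (\<lambda>v. if fst v = k then 0 else pt v))"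
  proof (intro sum.cong refl)
    fix \<mu>
    show "?c \<mu> * monom_eval \<mu> pt = lookup P \<mu> * monom_eval \<mu> (\<lambda>v. if fst v = k then 0 else pt v)"
    proof (cases "\<exists>v\<in>keys \<mu>. fst v = k")
      case True
      then have "monom_eval \<mu> (\<lambda>v. if fst v = k then 0 else pt v) = 0"
        unfolding monom_eval_def by (intro prod_zero) (auto simp: in_keys_iff)
      then show ?thesis using True by simp
    next
      case False
      then have "monom_eval \<mu> (\<lambda>v. if fst v = k then 0 else pt v) = monom_eval \<mu> pt"
        unfolding monom_eval_def by (intro prod.cong) auto
      then show ?thesis using False by simp
    qed
  qed
  finally show ?thesis
    by (simp add: meval_eq)
qed

section \<open>Polynomials in the generators satisfy the defining conditions\<close>

lemma compatible_gen_eval: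
  assumes "1 \<le> n" "mvars Q \<subseteq> gen_index n"
  shows "compatible n (gen_eval n Q)"
  unfolding compatible_def
proof (intro allI conjI)
  fix m
  show "gen_eval n Q m \<in> Aring n m"
    unfolding Aring_iff
  proof (intro conjI allI impI gen_eval_Pring)
    fix \<sigma> :: "nat \<Rightarrow> nat" and pt :: "var \<Rightarrow> real"
    assume \<sigma>: "\<sigma> permutes {1..m}"
    have "block_pair (pt \<circ> ren \<sigma>) = block_pair pt \<circ> \<sigma>"
      by (simp add: fun_eq_iff block_pair_def ren_def)
    then show "meval (gen_eval n Q m) (pt \<circ> ren \<sigma>) = meval (gen_eval n Q m) pt"
      using sum.permute[OF \<sigma>, of "\<lambda>i. pair_monom n _ (block_pair pt i)"]
      by (simp add: meval_gen_eval comp_def)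
  qed
  show "proj m (gen_eval n Q (Suc m)) = gen_eval n Q m"
  proof (rule meval_inject)
    fix pt :: "var \<Rightarrow> real"
    let ?pt = "\<lambda>v. if fst v = Suc m then 0 else pt v"
    \<comment> \<open>The block that is set to zero is the pair (0, 0). It is degenerate because
      coordinate 1 exists, so its summand drops out.\<close>
    have "pair_monom n g (block_pair ?pt (Suc m)) = 0" if "g \<in> gen_index n" for g
      using assms(1) that
      by (intro pair_monom_degenerate) (auto simp: degenerate_def block_pair_def intro!: bexI[of _ 1])
    moreover have "block_pair ?pt i = block_pair pt i" if "i \<in> {1..m}" for i
      using that by (auto simp: block_pair_def)
    ultimately show "meval (proj m (gen_eval n Q (Suc m))) pt = meval (gen_eval n Q m) pt"
      unfolding proj_def meval_zero_block meval_gen_eval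
      using assms(2) by (intro meval_cong) (auto simp: subset_iff)
  qed
qed

lemma homogeneous_gen_eval_single:
  "\<exists>d. \<forall>m. homogeneous d (gen_eval n (Poly_Mapping.single \<mu> c) m)"
proof -
  \<comment> \<open>The factors 1 are the degrees of \<open>eta\<close> and \<open>xi\<close>;
    \<open>e g\<close> is the degree of the generator with index \<open>g\<close>.\<close>
  define e where "e g = (\<Sum>j\<in>{1..n}. fst g ! (j - 1) * 1 + snd g ! (j - 1) * 1)" for g :: "nat list \<times> nat list"
  have "homogeneous 1 (eta i j)" "homogeneous 1 (xi i j)" for i j
    unfolding eta_def xi_def by (intro homogeneous_diff homogeneous_add homogeneous_mvar)+
  then have "homogeneous (e g) (pfam n g m)" for g m
    unfolding pfam_def e_def
    by (intro homogeneous_sum homogeneous_prod homogeneous_mult homogeneous_power)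
  then have "homogeneous (0 + (\<Sum>g\<in>keys \<mu>. lookup \<mu> g * e g)) (gen_eval n (Poly_Mapping.single \<mu> c) m)" for m
    unfolding gen_eval_def
    by (intro homogeneous_sum homogeneous_mult homogeneous_mconst)
      (auto intro!: homogeneous_prod homogeneous_power split: if_splits)
  then show ?thesis by blast
qed

lemma gen_eval_Afin:
  assumes "1 \<le> n" "mvars Q \<subseteq> gen_index n"
  shows "gen_eval n Q \<in> Afin n"
proof -
  \<comment> \<open>The components in \<open>Afin\<close> are indexed by natural numbers, so the
    monomials of \<open>Q\<close> are numbered; each one gives a homogeneous family.\<close>
  obtain h where h: "bij_betw h {0..<card (keys Q)} (keys Q)"
    using ex_bij_betw_nat_finite[OF finite_keys] by blast
  define G where "G k = gen_eval n (Poly_Mapping.single (h k) (lookup Q (h k)))" for k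
  have "hom_family n (G k)" if "k \<in> {0..<card (keys Q)}" for k
  proof -
    have "h k \<in> keys Q"
      using h that by (auto simp: bij_betw_def)
    then have "mvars (Poly_Mapping.single (h k) (lookup Q (h k))) \<subseteq> gen_index n"
      using assms(2) by (auto simp: mvars_def split: if_splits)
    then show ?thesis
      unfolding G_def hom_family_def
      using compatible_gen_eval[OF assms(1)] homogeneous_gen_eval_single by blast
  qed
  moreover have "gen_eval n Q = (\<lambda>m. \<Sum>k\<in>{0..<card (keys Q)}. G k m)"
  proof
    fix m
    have "(\<Sum>k\<in>{0..<card (keys Q)}. G k m)
        = (\<Sum>\<mu>\<in>keys Q. gen_eval n (Poly_Mapping.single \<mu> (lookup Q \<mu>)) m)"
      unfolding G_def by (rule sum.reindex_bij_betw[OF h])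
    also have "\<dots> = gen_eval n Q m"
      unfolding gen_eval_def by (intro sum.cong refl) (auto simp: in_keys_iff)
    finally show "gen_eval n Q m = (\<Sum>k\<in>{0..<card (keys Q)}. G k m)" ..
  qed
  ultimately show ?thesis
    unfolding Afin_def by blast
qed

lemma gen_eval_Asp:
  assumes "1 \<le> n" "mvars Q \<subseteq> gen_index n"
  shows "gen_eval n Q \<in> Asp n"
proof -
  have "phi (X @ [z]) (gen_eval n Q) = phi X (gen_eval n Q)" if "degenerate n z" for X z
    unfolding phi_gen_eval
  proof (rule meval_cong)
    fix g assume "g \<in> mvars Q"
    then have "pair_monom n g z = 0"
      using assms(2) that by (intro pair_monom_degenerate) auto
    then show "psum n (X @ [z]) g = psum n X g"
      by (simp add: psum_def nth_append)
  qed
  then show ?thesis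
    using gen_eval_Afin[OF assms] by (auto simp: Asp_def)
qed

section \<open>Elements of the limit as functions of finite multisets\<close>

lemma AfinE:
  assumes "f \<in> Afin n"
  obtains K :: "nat set" and G where "finite K" "\<And>k. k \<in> K \<Longrightarrow> hom_family n (G k)"
    "f = (\<lambda>m. \<Sum>k\<in>K. G k m)"
  using assms by (auto simp: Afin_def)

lemma Afin_Aring:
  assumes "f \<in> Afin n"
  shows "f m \<in> Aring n m"
proof -
  obtain K :: "nat set" and G where K: "finite K" "\<And>k. k \<in> K \<Longrightarrow> hom_family n (G k)" "f = (\<lambda>m. \<Sum>k\<in>K. G k m)"
    by (rule AfinE[OF assms]) (rule that)
  have A: "G k m \<in> Aring n m" if "k \<in> K" for k
    using K(2)[OF that] by (auto simp: hom_family_def compatible_def)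
  then have "mvars (f m) \<subseteq> block_vars n m"
    unfolding K(3) by (intro order_trans[OF mvars_sum] UN_least) (auto simp: Aring_iff Pring_iff)
  then show ?thesis
    using A by (simp add: Aring_iff Pring_iff K(3) meval_sum cong: sum.cong)
qed

text \<open>A family has finitely many homogeneous components, whose degrees do not depend on
  \<open>m\<close>. The uniform bound later limits the size of the subsets in the Newton
  expansion.\<close>

lemma Afin_bounded_degree:
  assumes "f \<in> Afin n"
  shows "\<exists>d. \<forall>m. \<forall>\<mu>\<in>keys (f m). mdeg \<mu> \<le> d"
proof -
  obtain K :: "nat set" and G where K: "finite K" "\<And>k. k \<in> K \<Longrightarrow> hom_family n (G k)" "f = (\<lambda>m. \<Sum>k\<in>K. G k m)"
    by (rule AfinE[OF assms]) (rule that)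
  have "\<forall>k\<in>K. \<exists>d. \<forall>m. homogeneous d (G k m)"
    using K(2) by (simp add: hom_family_def)
  then obtain d where d: "\<And>k m. k \<in> K \<Longrightarrow> homogeneous (d k) (G k m)"
    by metis
  have "mdeg \<mu> \<le> (\<Sum>k\<in>K. d k)" if \<mu>: "\<mu> \<in> keys (f m)" for m \<mu>
  proof -
    obtain k where k: "k \<in> K" "\<mu> \<in> keys (G k m)"
      using \<mu> keys_sum[of "\<lambda>k. G k m" K] K(3) by auto
    then have "mdeg \<mu> = d k"
      using d by (auto simp: homogeneous_def)
    then show ?thesis
      using member_le_sum[of k K d] k K(1) by simp
  qed
  then show ?thesis by blast
qed

lemma phi_mset:
  assumes "f \<in> Afin n" "mset X = mset Y"
  shows "phi X f = phi Y f"
proof -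
  let ?m = "length Y"
  have len: "length X = ?m"
    using assms(2) mset_eq_length by blast
  obtain p where p: "p permutes {..<?m}" "permute_list p Y = X"
    using mset_eq_permutation[OF assms(2)] by blast
  \<comment> \<open>\<open>p\<close> permutes list positions counted from 0, whereas blocks are
    counted from 1.\<close>
  define \<sigma> where "\<sigma> i = (if i \<in> {1..?m} then Suc (p (i - 1)) else i)" for i
  have "\<sigma> permutes {1..?m}"
  proof (rule bij_imp_permutes)
    have "bij_betw (Suc \<circ> p \<circ> (\<lambda>i. i - 1)) {1..?m} {1..?m}"
    proof (intro bij_betw_trans)
      show "bij_betw (\<lambda>i. i - 1) {1..?m} {..<?m}"
        by (rule bij_betw_byWitness[where f' = Suc]) auto
      show "bij_betw p {..<?m} {..<?m}"
        using p(1) by (rule permutes_imp_bij)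
      show "bij_betw Suc {..<?m} {1..?m}"
        by (rule bij_betw_byWitness[where f' = "\<lambda>i. i - 1"]) auto
    qed
    then show "bij_betw \<sigma> {1..?m} {1..?m}"
      by (rule bij_betw_cong[THEN iffD1, rotated]) (auto simp: \<sigma>_def)
  qed (auto simp: \<sigma>_def)
  moreover have "point X = point Y \<circ> ren \<sigma>"
  proof -
    have "X ! (i - 1) = Y ! p (i - 1)" "p (i - 1) < ?m" if "i \<in> {1..?m}" for i
    proof -
      have i: "i - 1 < ?m" using that by auto
      show "X ! (i - 1) = Y ! p (i - 1)"
        using p i by (metis permute_list_nth)
      show "p (i - 1) < ?m"
        using permutes_in_image[OF p(1), of "i - 1"] i by auto
    qed
    then show ?thesis
      using len by (auto simp: fun_eq_iff point_def ren_def \<sigma>_def Suc_le_eq)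
  qed
  ultimately show ?thesis
    using Afin_Aring[OF assms(1), of ?m] len by (simp add: phi_def Aring_iff)
qed

text \<open>Every assignment agrees on the variables of the first \<open>m\<close> blocks with the
  \<open>point\<close> of a list of length \<open>m\<close>, and on such a list \<open>phi\<close>
  evaluates exactly level \<open>m\<close>.\<close>

lemma family_eqI:
  assumes "\<And>m. f m \<in> Pring n m" "\<And>m. g m \<in> Pring n m" "\<And>X. phi X f = phi X g"
  shows "f = g"
proof
  fix m
  show "f m = g m"
  proof (rule meval_inject)
    fix pt
    let ?X = "map (block_pair pt) [1..<Suc m]"
    have "meval P pt = meval P (point ?X)" if "P \<in> Pring n m" for P
    proof (rule meval_cong)
      fix v assume "v \<in> mvars P"
      then have "v \<in> block_vars n m"
        using that by (auto simp: Pring_iff)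
      then show "pt v = point ?X v"
        by (auto simp: block_vars_def point_def block_pair_def simp del: upt_Suc)
    qed
    then show "meval (f m) pt = meval (g m) pt"
      using assms(1,2)[of m] assms(3)[of ?X] by (simp add: phi_def del: upt_Suc)
  qed
qed

section \<open>Algebraic independence\<close>

definition point_combination :: "(('z \<Rightarrow> real) \<Rightarrow> real) \<Rightarrow> bool" where
  "point_combination L \<longleftrightarrow> (\<exists>Z r. finite Z \<and> (\<forall>\<phi>. L \<phi> = (\<Sum>z\<in>Z. r z * \<phi> z)))"

lemma point_combination_zero: "point_combination (\<lambda>_. 0)"
  unfolding point_combination_def by (rule exI[of _ "{}"]) auto

lemma point_combination_at: "point_combination (\<lambda>\<phi>. t * \<phi> z)"
  unfolding point_combination_def by (intro exI[of _ "{z}"] exI[of _ "\<lambda>_. t"]) auto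

lemma point_combination_add:
  assumes "point_combination L" "point_combination L'"
  shows "point_combination (\<lambda>\<phi>. L \<phi> + L' \<phi>)"
proof -
  obtain Z r Z' r' where Z: "finite Z" "\<And>\<phi>. L \<phi> = (\<Sum>z\<in>Z. r z * \<phi> z)"
    and Z': "finite Z'" "\<And>\<phi>. L' \<phi> = (\<Sum>z\<in>Z'. r' z * \<phi> z)"
    using assms unfolding point_combination_def by blast
  let ?r = "\<lambda>z. (if z \<in> Z then r z else 0)" and ?r' = "\<lambda>z. (if z \<in> Z' then r' z else 0)"
  have "L \<phi> = (\<Sum>z\<in>Z \<union> Z'. ?r z * \<phi> z)" "L' \<phi> = (\<Sum>z\<in>Z \<union> Z'. ?r' z * \<phi> z)" for \<phi>
    unfolding Z(2) Z'(2) using Z(1) Z'(1) by (auto intro!: sum.mono_neutral_cong_left)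
  then show ?thesis
    unfolding point_combination_def using Z(1) Z'(1)
    by (intro exI[of _ "Z \<union> Z'"] exI[of _ "\<lambda>z. ?r z + ?r' z"])
      (simp add: distrib_right sum.distrib)
qed

lemma point_combination_cmult:
  assumes "point_combination L"
  shows "point_combination (\<lambda>\<phi>. t * L \<phi>)"
proof -
  obtain Z r where "finite Z" "\<And>\<phi>. L \<phi> = (\<Sum>z\<in>Z. r z * \<phi> z)"
    using assms unfolding point_combination_def by blast
  then show ?thesis
    unfolding point_combination_def
    by (intro exI[of _ Z] exI[of _ "\<lambda>z. t * r z"]) (simp add: sum_distrib_left mult.assoc)
qed

lemma point_combination_sum:
  "(\<And>i. i \<in> I \<Longrightarrow> point_combination (L i)) \<Longrightarrow> point_combination (\<lambda>\<phi>. \<Sum>i\<in>I. L i \<phi>)"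
  by (induction I rule: infinite_finite_induct)
    (auto intro: point_combination_zero point_combination_add)

text \<open>Finite-dimensional duality: evaluations span the dual of the span of finitely many
  independent functions. The induction adds one function at a time and uses functionals dual to the
  previous ones.\<close>

lemma point_combination_interpolates:
  fixes q :: "'g \<Rightarrow> 'z \<Rightarrow> real"
  assumes "finite C"
    and "\<And>c. (\<And>z. (\<Sum>g\<in>C. c g * q g z) = 0) \<Longrightarrow> \<forall>g\<in>C. c g = 0"
  shows "\<exists>L. point_combination L \<and> (\<forall>g\<in>C. L (q g) = v g)"
  using assms
proof (induction C arbitrary: v rule: finite_induct)
  case empty
  then show ?case using point_combination_zero by blast
next
  case (insert g0 C)
  have "\<forall>g\<in>C. c g = 0" if "\<And>z. (\<Sum>g\<in>C. c g * q g z) = 0" for c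
  proof -
    have "(\<Sum>g\<in>insert g0 C. (c(g0 := 0)) g * q g z) = (\<Sum>g\<in>C. c g * q g z)" for z
      using insert.hyps by (auto intro!: sum.cong)
    then have "\<forall>g\<in>insert g0 C. (c(g0 := 0)) g = 0"
      using that by (intro insert.prems) simp
    then show ?thesis
      using insert.hyps by (auto split: if_splits)
  qed
  then have IH: "\<exists>L. point_combination L \<and> (\<forall>g\<in>C. L (q g) = v g)" for v
    by (rule insert.IH)
  have "\<forall>g. \<exists>L. point_combination L \<and> (\<forall>g'\<in>C. L (q g') = (if g' = g then 1 else 0))"
    by (rule allI) (rule IH)
  then obtain W where W: "\<And>g. point_combination (W g)"
    "\<And>g g'. g' \<in> C \<Longrightarrow> W g (q g') = (if g' = g then 1 else 0)"
    by metis
  \<comment> \<open>\<open>h\<close> is \<open>q g0\<close> minus the combination of the earlier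
    functions that has the same values under all \<open>W g\<close>. If it vanished identically, it
    would be a linear relation with coefficient 1 at \<open>g0\<close>.\<close>
  define h where "h z = q g0 z - (\<Sum>g\<in>C. W g (q g0) * q g z)" for z
  have "\<exists>z. h z \<noteq> 0"
  proof (rule ccontr)
    assume "\<not> (\<exists>z. h z \<noteq> 0)"
    let ?c = "\<lambda>g. if g = g0 then 1 else - W g (q g0)"
    have "(\<Sum>g\<in>insert g0 C. ?c g * q g z) = h z" for z
    proof -
      have "(\<Sum>g\<in>C. ?c g * q g z) = (\<Sum>g\<in>C. - (W g (q g0) * q g z))"
        using insert.hyps by (intro sum.cong) auto
      then show ?thesis
        using insert.hyps by (simp add: h_def sum_negf)
    qed
    then have "\<forall>g\<in>insert g0 C. ?c g = 0"
      using \<open>\<not> (\<exists>z. h z \<noteq> 0)\<close> by (intro insert.prems) auto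
    then show False by auto
  qed
  then obtain z0 where z0: "h z0 \<noteq> 0" by blast
  \<comment> \<open>Evaluation at \<open>z0\<close> gets weight \<open>t\<close>; the dual
    functionals correct its effect on \<open>C\<close>. What remains at \<open>g0\<close> is
    \<open>t * h z0\<close> plus the old interpolation value, and solving for \<open>v g0\<close>
    gives \<open>t\<close>.\<close>
  define t where "t = (v g0 - (\<Sum>g\<in>C. v g * W g (q g0))) / h z0"
  define L where "L \<phi> = t * \<phi> z0 + (\<Sum>g\<in>C. (v g - t * q g z0) * W g \<phi>)" for \<phi>
  have "point_combination L"
    unfolding L_def
    by (intro point_combination_add point_combination_at point_combination_sum
        point_combination_cmult W)
  moreover have "L (q g) = v g" if "g \<in> C" for g
  proof -
    have "(\<Sum>g'\<in>C. (v g' - t * q g' z0) * W g' (q g)) = (\<Sum>g'\<in>C. if g' = g then v g - t * q g z0 else 0)"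
      using W(2)[OF that] by (intro sum.cong) auto
    then show ?thesis
      using that insert.hyps by (simp add: L_def)
  qed
  moreover have "L (q g0) = v g0"
  proof -
    have "L (q g0) = t * h z0 + (\<Sum>g\<in>C. v g * W g (q g0))"
      by (simp add: L_def h_def algebra_simps sum_subtractf sum_distrib_left)
    then show ?thesis
      using z0 by (simp add: t_def)
  qed
  ultimately show ?case by blast
qed

lemma pair_monom_halves:
  "pair_monom n g (\<lambda>j. (\<xi> j - \<eta> j) / 2, \<lambda>j. (\<xi> j + \<eta> j) / 2)
    = (\<Prod>j\<in>{1..n}. \<eta> j ^ (fst g ! (j - 1)) * \<xi> j ^ (snd g ! (j - 1)))"
proof -
  have "(\<xi> j + \<eta> j) / 2 - (\<xi> j - \<eta> j) / 2 = \<eta> j" "(\<xi> j + \<eta> j) / 2 + (\<xi> j - \<eta> j) / 2 = \<xi> j" for j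
    by (simp_all add: field_simps)
  then show ?thesis
    by (simp add: pair_monom_def)
qed

text \<open>In the coordinates \<eta> and \<xi> these functions are distinct monomials, the
  exponents being exactly the entries of the index lists.\<close>

lemma pair_monom_independent:
  assumes "finite C" "C \<subseteq> gen_index n" "\<And>z. (\<Sum>g\<in>C. c g * pair_monom n g z) = 0" "g \<in> C"
  shows "c g = 0"
proof (rule monomials_independent[of "{1..n} \<times> (UNIV :: bool set)" C UNIV
      "\<lambda>g (j, s). if s then fst g ! (j - 1) else snd g ! (j - 1)"])
  fix s s'
  assume s: "s \<in> C" "s' \<in> C" and eq: "\<And>v. v \<in> {1..n} \<times> UNIV \<Longrightarrow>
      (case v of (j, t) \<Rightarrow> if t then fst s ! (j - 1) else snd s ! (j - 1)) =
      (case v of (j, t) \<Rightarrow> if t then fst s' ! (j - 1) else snd s' ! (j - 1))"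
  have "length (fst s) = n" "length (fst s') = n" "length (snd s) = n" "length (snd s') = n"
    using s assms(2) by (auto simp: gen_index_def)
  moreover have "fst s ! j = fst s' ! j" "snd s ! j = snd s' ! j" if "j < n" for j
    using eq[of "(Suc j, True)"] eq[of "(Suc j, False)"] that by auto
  ultimately show "s = s'"
    by (auto intro!: prod_eqI nth_equalityI)
next
  fix pt :: "nat \<times> bool \<Rightarrow> real"
  \<comment> \<open>The pair whose \<eta>-coordinates are the values of \<open>pt\<close> with flag
    \<open>True\<close> and whose \<xi>-coordinates are those with flag
    \<open>False\<close>.\<close>
  let ?z = "(\<lambda>j. (pt (j, False) - pt (j, True)) / 2, \<lambda>j. (pt (j, False) + pt (j, True)) / 2)"
  have "pair_monom n g ?z = (\<Prod>v\<in>{1..n} \<times> UNIV. pt v ^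
        (case v of (j, s) \<Rightarrow> if s then fst g ! (j - 1) else snd g ! (j - 1)))" for g
  proof -
    have "(\<Prod>v\<in>{1..n} \<times> UNIV. pt v ^
        (case v of (j, s) \<Rightarrow> if s then fst g ! (j - 1) else snd g ! (j - 1)))
      = (\<Prod>j\<in>{1..n}. \<Prod>s\<in>UNIV. pt (j, s) ^ (if s then fst g ! (j - 1) else snd g ! (j - 1)))"
      unfolding prod.cartesian_product by (rule prod.cong) auto
    then show ?thesis
      unfolding pair_monom_halves[where \<xi> = "\<lambda>j. pt (j, False)" and \<eta> = "\<lambda>j. pt (j, True)"]
      by (simp add: UNIV_bool mult.commute)
  qed
  then show "(\<Sum>g\<in>C. c g * (\<Prod>v\<in>{1..n} \<times> UNIV. pt v ^
        (case v of (j, s) \<Rightarrow> if s then fst g ! (j - 1) else snd g ! (j - 1)))) = 0"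
    using assms(3)[of ?z] by simp
qed (use assms in \<open>auto simp: infinite_UNIV_char_0\<close>)

lemma list_with_multiplicities:
  assumes "finite Z"
  shows "\<exists>X. \<forall>\<phi>. (\<Sum>x\<leftarrow>X. \<phi> x) = (\<Sum>z\<in>Z. real (k z) * \<phi> z)"
  using assms
proof (induction Z rule: finite_induct)
  case empty
  then show ?case by (intro exI[of _ "[]"]) auto
next
  case (insert z Z)
  then obtain X where "\<forall>\<phi>. (\<Sum>x\<leftarrow>X. \<phi> x) = (\<Sum>z\<in>Z. real (k z) * \<phi> z)" by blast
  then show ?case
    using insert.hyps
    by (intro exI[of _ "replicate (k z) z @ X"]) (simp add: sum_list_replicate)
qed

lemma psum_sum_list: "psum n X g = (\<Sum>x\<leftarrow>X. pair_monom n g x)"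
  by (simp add: psum_def sum_list_sum_nth atLeast0LessThan)

text \<open>It suffices to let the power sums occurring in \<open>R\<close> take arbitrary real
  values. Multisets only give natural multiplicities, but for fixed points the relation is
  polynomial in the multiplicities and so extends to real weights.\<close>

lemma psum_algebraically_independent:
  assumes "mvars R \<subseteq> gen_index n" "\<And>X. meval R (psum n X) = 0"
  shows "R = 0"
proof (rule meval_eq_0_imp[where A = UNIV])
  fix v
  have "\<exists>L. point_combination L \<and> (\<forall>g\<in>mvars R. L (pair_monom n g) = v g)"
  proof (rule point_combination_interpolates[OF finite_mvars], rule ballI)
    fix c g
    assume "\<And>z. (\<Sum>g\<in>mvars R. c g * pair_monom n g z) = 0" "g \<in> mvars R"
    then show "c g = 0"
      by (rule pair_monom_independent[OF finite_mvars assms(1)])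
  qed
  then obtain L where L: "point_combination L" "\<forall>g\<in>mvars R. L (pair_monom n g) = v g"
    by (elim exE conjE) (rule that)
  from L(1) obtain Z r where Z: "finite Z" "\<And>\<phi>. L \<phi> = (\<Sum>z\<in>Z. r z * \<phi> z)"
    unfolding point_combination_def by blast
  \<comment> \<open>From here the points \<open>Z\<close> are fixed and the weights \<open>r\<close>
    become the variables.\<close>
  have "polyfun UNIV (\<Sum>\<mu>\<in>keys R. mdeg \<mu>)
      (\<lambda>r. meval R (\<lambda>g. \<Sum>z\<in>Z. r z * pair_monom n g z))"
  proof (rule polyfun_compose_linear)
    show "mdeg \<mu> \<le> (\<Sum>\<mu>\<in>keys R. mdeg \<mu>)" if "\<mu> \<in> keys R" for \<mu>
      using that by (intro member_le_sum) auto
    show "polyfun UNIV 1 (\<lambda>r. \<Sum>z\<in>Z. r z * pair_monom n g z)" for g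
      unfolding mult.commute[of _ "pair_monom n g _"]
      by (intro polyfun_sum polyfun_cmult polyfun_var UNIV_I)
  qed
  then obtain S where S: "\<And>r. meval R (\<lambda>g. \<Sum>z\<in>Z. r z * pair_monom n g z) = meval S r"
    unfolding polyfun_def by auto
  have "S = 0"
  proof (rule meval_eq_0_imp)
    show "infinite (range real)"
      by (simp add: finite_image_iff inj_of_nat)
    \<comment> \<open>Natural weights are realized by an actual list with repeated points, where the
      relation holds by assumption.\<close>
    fix r :: "pair \<Rightarrow> real" assume "\<And>z. r z \<in> range real"
    then obtain k where k: "\<And>z. r z = real (k z)"
      unfolding image_iff by metis
    obtain X where "\<And>\<phi>. (\<Sum>x\<leftarrow>X. \<phi> x) = (\<Sum>z\<in>Z. real (k z) * \<phi> z)"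
      using list_with_multiplicities[OF Z(1)] by blast
    then have "psum n X = (\<lambda>g. \<Sum>z\<in>Z. r z * pair_monom n g z)"
      by (simp add: psum_sum_list k fun_eq_iff)
    then show "meval S r = 0"
      using assms(2)[of X] S[of r] by simp
  qed
  \<comment> \<open>With the weights defining \<open>L\<close>, the weighted power sums are the
    prescribed values \<open>v\<close>.\<close>
  moreover have "meval R v = meval R (\<lambda>g. \<Sum>z\<in>Z. r z * pair_monom n g z)"
    by (rule meval_cong) (use L(2) Z(2) in auto)
  ultimately show "meval R v = 0"
    using S[of r] by simp
qed (simp add: infinite_UNIV_char_0)

lemma inj_on_gen_eval: "inj_on (gen_eval n) {Q. mvars Q \<subseteq> gen_index n}"
proof (rule inj_onI)
  fix Q Q' assume Q: "Q \<in> {Q. mvars Q \<subseteq> gen_index n}" "Q' \<in> {Q. mvars Q \<subseteq> gen_index n}"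
    "gen_eval n Q = gen_eval n Q'"
  have "Q - Q' = 0"
  proof (rule psum_algebraically_independent)
    show "mvars (Q - Q') \<subseteq> gen_index n"
      using Q mvars_diff[of Q Q'] by auto
    show "meval (Q - Q') (psum n X) = 0" for X
      using Q(3) by (metis diff_self meval_diff phi_gen_eval)
  qed
  then show "Q = Q'" by simp
qed

section \<open>Functions generated by the power sums\<close>

definition psum_algebra :: "nat \<Rightarrow> (pair list \<Rightarrow> real) set" where
  "psum_algebra n = {h. \<exists>Q. mvars Q \<subseteq> gen_index n \<and> (\<forall>X. h X = meval Q (psum n X))}"

lemma psum_algebraI:
  "mvars Q \<subseteq> gen_index n \<Longrightarrow> (\<And>X. h X = meval Q (psum n X)) \<Longrightarrow> h \<in> psum_algebra n"
  by (auto simp: psum_algebra_def)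

lemma psum_algebra_const: "(\<lambda>_. c) \<in> psum_algebra n"
  by (rule psum_algebraI[of "mconst c"]) auto

lemma psum_algebra_psum: "g \<in> gen_index n \<Longrightarrow> (\<lambda>X. psum n X g) \<in> psum_algebra n"
  by (rule psum_algebraI[of "mvar g"]) auto

lemma psum_algebra_add:
  assumes "h \<in> psum_algebra n" "k \<in> psum_algebra n"
  shows "(\<lambda>X. h X + k X) \<in> psum_algebra n"
proof -
  obtain P Q where "mvars P \<subseteq> gen_index n" "\<And>X. h X = meval P (psum n X)"
    "mvars Q \<subseteq> gen_index n" "\<And>X. k X = meval Q (psum n X)"
    using assms by (auto simp: psum_algebra_def)
  then show ?thesis
    using mvars_add[of P Q] by (intro psum_algebraI[of "P + Q"]) (auto simp: meval_add)
qed

lemma psum_algebra_mult: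
  assumes "h \<in> psum_algebra n" "k \<in> psum_algebra n"
  shows "(\<lambda>X. h X * k X) \<in> psum_algebra n"
proof -
  obtain P Q where "mvars P \<subseteq> gen_index n" "\<And>X. h X = meval P (psum n X)"
    "mvars Q \<subseteq> gen_index n" "\<And>X. k X = meval Q (psum n X)"
    using assms by (auto simp: psum_algebra_def)
  then show ?thesis
    using mvars_mult[of P Q] by (intro psum_algebraI[of "P * Q"]) (auto simp: meval_mult)
qed

lemma psum_algebra_cmult: "h \<in> psum_algebra n \<Longrightarrow> (\<lambda>X. c * h X) \<in> psum_algebra n"
  by (rule psum_algebra_mult[OF psum_algebra_const])

lemma psum_algebra_diff:
  "h \<in> psum_algebra n \<Longrightarrow> k \<in> psum_algebra n \<Longrightarrow> (\<lambda>X. h X - k X) \<in> psum_algebra n"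
  using psum_algebra_add[of h n "\<lambda>X. (- 1) * k X"] psum_algebra_cmult[of k n "- 1"] by simp

lemma psum_algebra_sum:
  "(\<And>i. i \<in> I \<Longrightarrow> h i \<in> psum_algebra n) \<Longrightarrow> (\<lambda>X. \<Sum>i\<in>I. h i X) \<in> psum_algebra n"
  by (induction I rule: infinite_finite_induct) (auto intro: psum_algebra_const psum_algebra_add)

text \<open>Exponents add, and sums of positive exponents stay positive. This closure is what keeps
  merged factors inside the generating set.\<close>

lemma pair_monom_mult:
  assumes "g \<in> gen_index n" "h \<in> gen_index n"
  shows "\<exists>k\<in>gen_index n. (\<lambda>z. pair_monom n g z * pair_monom n h z) = pair_monom n k"
proof (intro bexI ext)
  let ?k = "(map2 (+) (fst g) (fst h), map2 (+) (snd g) (snd h))"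
  show "?k \<in> gen_index n"
    using assms by (auto simp: gen_index_def dest: set_zip_leftD)
  have len: "length (fst g) = n" "length (fst h) = n" "length (snd g) = n" "length (snd h) = n"
    using assms by (auto simp: gen_index_def)
  show "pair_monom n g z * pair_monom n h z = pair_monom n ?k z" for z
    unfolding pair_monom_def prod.distrib[symmetric]
  proof (intro prod.cong refl)
    fix j assume "j \<in> {1..n}"
    then have "j - 1 < n" by auto
    then show "(snd z j - fst z j) ^ (fst g ! (j - 1)) * (snd z j + fst z j) ^ (snd g ! (j - 1)) *
        ((snd z j - fst z j) ^ (fst h ! (j - 1)) * (snd z j + fst z j) ^ (snd h ! (j - 1))) =
      (snd z j - fst z j) ^ (fst ?k ! (j - 1)) * (snd z j + fst z j) ^ (snd ?k ! (j - 1))"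
      by (simp add: len power_add)
  qed
qed

section \<open>Sums over tuples of distinct indices\<close>

definition distinct_lists :: "nat \<Rightarrow> nat \<Rightarrow> nat list set" where
  "distinct_lists m k = {I. distinct I \<and> set I \<subseteq> {..<m} \<and> length I = k}"

definition distinct_sum :: "(pair \<Rightarrow> real) list \<Rightarrow> pair list \<Rightarrow> real" where
  "distinct_sum \<phi>s X =
     (\<Sum>I\<in>distinct_lists (length X) (length \<phi>s). \<Prod>l<length \<phi>s. (\<phi>s ! l) (X ! (I ! l)))"

lemma finite_distinct_lists [simp]: "finite (distinct_lists m k)"
  by (rule finite_subset[OF _ finite_lists_length_eq[of "{..<m}" k]]) (auto simp: distinct_lists_def)

lemma sum_distinct_lists_Suc:
  "(\<Sum>I\<in>distinct_lists m (Suc k). h I) =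
   (\<Sum>I\<in>distinct_lists m k. \<Sum>i\<in>{..<m} - set I. (h (i # I) :: real))"
proof -
  have "(\<Sum>I\<in>distinct_lists m k. \<Sum>i\<in>{..<m} - set I. h (i # I)) =
        (\<Sum>(I, i)\<in>(SIGMA I:distinct_lists m k. {..<m} - set I). h (i # I))"
    by (rule sum.Sigma) auto
  also have "\<dots> = (\<Sum>I\<in>distinct_lists m (Suc k). h I)"
    by (rule sum.reindex_bij_witness[of _ "\<lambda>I. (tl I, hd I)" "\<lambda>(I, i). i # I"])
      (auto simp: distinct_lists_def length_Suc_conv)
  finally show ?thesis ..
qed

text \<open>Let the index of \<phi> first run over all positions, then subtract the collisions: if
  it equals the index of the \<open>l\<close>-th factor, \<phi> merges with that factor into a
  product.\<close>

lemma distinct_sum_Cons: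
  "distinct_sum (\<phi> # \<psi>s) X = (\<Sum>i<length X. \<phi> (X ! i)) * distinct_sum \<psi>s X -
     (\<Sum>l<length \<psi>s. distinct_sum (\<psi>s[l := \<lambda>z. \<phi> z * (\<psi>s ! l) z]) X)"
proof -
  let ?m = "length X" and ?k = "length \<psi>s"
  let ?p = "\<lambda>I. \<Prod>l<?k. (\<psi>s ! l) (X ! (I ! l))"
  have step: "(\<Sum>i\<in>{..<?m} - set I. \<phi> (X ! i) * ?p I) = (\<Sum>i<?m. \<phi> (X ! i)) * ?p I -
      (\<Sum>l<?k. \<Prod>l'<?k. (\<psi>s[l := \<lambda>z. \<phi> z * (\<psi>s ! l) z] ! l') (X ! (I ! l')))"
    if I: "I \<in> distinct_lists ?m ?k" for I
  proof -
    have "(\<Sum>i\<in>set I. \<phi> (X ! i)) = (\<Sum>l<?k. \<phi> (X ! (I ! l)))"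
    proof -
      have "bij_betw ((!) I) {..<?k} (set I)"
        using I by (intro bij_betw_nth) (auto simp: distinct_lists_def)
      then show ?thesis
        by (rule sum.reindex_bij_betw[symmetric])
    qed
    then have "(\<Sum>i\<in>set I. \<phi> (X ! i) * ?p I) = (\<Sum>l<?k. \<phi> (X ! (I ! l)) * ?p I)"
      by (simp flip: sum_distrib_right)
    also have "\<dots> = (\<Sum>l<?k. \<Prod>l'<?k. (\<psi>s[l := \<lambda>z. \<phi> z * (\<psi>s ! l) z] ! l') (X ! (I ! l')))"
    proof (intro sum.cong refl)
      fix l assume l: "l \<in> {..<?k}"
      \<comment> \<open>Updating entry \<open>l\<close> changes the product by one factor, written
        as a product over all positions that is 1 away from \<open>l\<close>.\<close>
      have "(\<Prod>l'<?k. (\<psi>s[l := \<lambda>z. \<phi> z * (\<psi>s ! l) z] ! l') (X ! (I ! l'))) =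
        (\<Prod>l'<?k. (if l' = l then \<phi> (X ! (I ! l)) else 1) * (\<psi>s ! l') (X ! (I ! l')))"
        by (intro prod.cong refl) (auto simp: nth_list_update)
      also have "\<dots> = \<phi> (X ! (I ! l)) * ?p I"
        using l by (simp add: prod.distrib)
      finally show "\<phi> (X ! (I ! l)) * ?p I =
        (\<Prod>l'<?k. (\<psi>s[l := \<lambda>z. \<phi> z * (\<psi>s ! l) z] ! l') (X ! (I ! l')))" ..
    qed
    finally show ?thesis
      using I by (simp add: sum_diff distinct_lists_def sum_distrib_right)
  qed
  have "distinct_sum (\<phi> # \<psi>s) X = (\<Sum>I\<in>distinct_lists ?m ?k. \<Sum>i\<in>{..<?m} - set I. \<phi> (X ! i) * ?p I)"
    by (simp add: distinct_sum_def sum_distinct_lists_Suc prod.lessThan_Suc_shift del: prod.lessThan_Suc)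
  also have "\<dots> = (\<Sum>I\<in>distinct_lists ?m ?k. (\<Sum>i<?m. \<phi> (X ! i)) * ?p I -
      (\<Sum>l<?k. \<Prod>l'<?k. (\<psi>s[l := \<lambda>z. \<phi> z * (\<psi>s ! l) z] ! l') (X ! (I ! l'))))"
    by (intro sum.cong refl step)
  also have "\<dots> = (\<Sum>i<?m. \<phi> (X ! i)) * distinct_sum \<psi>s X -
     (\<Sum>l<?k. distinct_sum (\<psi>s[l := \<lambda>z. \<phi> z * (\<psi>s ! l) z]) X)"
    unfolding distinct_sum_def sum_subtractf length_list_update sum_distrib_left[symmetric]
    by (subst sum.swap) simp
  finally show ?thesis .
qed

lemma distinct_sum_psum_algebra:
  assumes "set \<phi>s \<subseteq> pair_monom n ` gen_index n"
  shows "distinct_sum \<phi>s \<in> psum_algebra n"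
  using assms
\<comment> \<open>The induction is on the length because the collision terms are shorter by one but
  have altered entries.\<close>
proof (induction "length \<phi>s" arbitrary: \<phi>s)
  case 0
  have "distinct_lists m 0 = {[]}" for m
    by (auto simp: distinct_lists_def)
  then have "distinct_sum [] = (\<lambda>_. 1)"
    by (simp add: distinct_sum_def fun_eq_iff)
  then show ?case
    using 0 psum_algebra_const[of 1 n] by simp
next
  case (Suc k)
  then obtain \<phi> \<psi>s where \<phi>s: "\<phi>s = \<phi> # \<psi>s" "k = length \<psi>s"
    by (cases \<phi>s) auto
  then obtain g where g: "g \<in> gen_index n" "\<phi> = pair_monom n g"
    using Suc.prems by auto
  have "distinct_sum (\<psi>s[l := \<lambda>z. \<phi> z * (\<psi>s ! l) z]) \<in> psum_algebra n" if l: "l < length \<psi>s" for l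
  proof (rule Suc.hyps(1))
    have "\<psi>s ! l \<in> pair_monom n ` gen_index n"
      using l Suc.prems \<phi>s(1) by auto
    then obtain h where h: "h \<in> gen_index n" "\<psi>s ! l = pair_monom n h"
      by blast
    have "(\<lambda>z. \<phi> z * (\<psi>s ! l) z) \<in> pair_monom n ` gen_index n"
      using pair_monom_mult[OF g(1) h(1)] by (simp add: g(2) h(2) image_iff)
    then show "set (\<psi>s[l := \<lambda>z. \<phi> z * (\<psi>s ! l) z]) \<subseteq> pair_monom n ` gen_index n"
      using Suc.prems \<phi>s(1) by (intro set_update_subsetI) auto
  qed (use \<phi>s in simp)
  moreover have "distinct_sum \<psi>s \<in> psum_algebra n"
    using Suc.prems \<phi>s by (intro Suc.hyps(1)) auto
  moreover have "(\<lambda>X. \<Sum>i<length X. \<phi> (X ! i)) \<in> psum_algebra n"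
    using psum_algebra_psum[OF g(1)] by (simp add: g(2) psum_def)
  ultimately have "(\<lambda>X. (\<Sum>i<length X. \<phi> (X ! i)) * distinct_sum \<psi>s X -
     (\<Sum>l\<in>{..<length \<psi>s}. distinct_sum (\<psi>s[l := \<lambda>z. \<phi> z * (\<psi>s ! l) z]) X)) \<in> psum_algebra n"
    by (intro psum_algebra_diff psum_algebra_mult psum_algebra_sum) auto
  then show ?case
    unfolding \<phi>s(1) distinct_sum_Cons[abs_def] .
qed

text \<open>Each subset of size \<open>k\<close> is the set of entries of exactly k! tuples. This is
  the symmetrization that passes from subsets to ordered tuples.\<close>

lemma sum_distinct_lists_set:
  "(\<Sum>I\<in>distinct_lists m k. H (set I)) = fact k * (\<Sum>S\<in>{S. S \<subseteq> {..<m} \<and> card S = k}. (H S :: real))"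
proof -
  let ?T = "{S. S \<subseteq> {..<m} \<and> card S = k}"
  have "(\<Sum>I\<in>distinct_lists m k. H (set I)) = (\<Sum>S\<in>?T. \<Sum>I\<in>{I \<in> distinct_lists m k. set I = S}. H (set I))"
    by (rule sum.group[OF finite_distinct_lists, symmetric])
      (auto simp: distinct_lists_def distinct_card)
  also have "\<dots> = (\<Sum>S\<in>?T. fact k * H S)"
  proof (intro sum.cong refl)
    fix S assume S: "S \<in> ?T"
    then have "{I \<in> distinct_lists m k. set I = S} = permutations_of_set S"
      by (auto simp: distinct_lists_def permutations_of_set_def distinct_card)
    moreover have "card (permutations_of_set S) = fact k"
      using S finite_subset[of S "{..<m}"] by (subst card_permutations_of_set) auto
    ultimately show "(\<Sum>I\<in>{I \<in> distinct_lists m k. set I = S}. H (set I)) = fact k * H S"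
      by (simp add: permutations_of_setD(1) cong: sum.cong)
  qed
  finally show ?thesis
    by (simp add: sum_distrib_left)
qed

section \<open>Newton expansion of a function of multisets\<close>

definition add_diff :: "'z \<Rightarrow> ('z multiset \<Rightarrow> real) \<Rightarrow> 'z multiset \<Rightarrow> real" where
  "add_diff z F M = F (add_mset z M) - F M"

definition iter_diff :: "('z multiset \<Rightarrow> real) \<Rightarrow> 'z multiset \<Rightarrow> 'z multiset \<Rightarrow> real" where
  "iter_diff F W = fold_mset add_diff F W"

text \<open>Commuting differences give the fold in \<open>iter_diff\<close> its recursion for any
  order of the points.\<close>

lemma comp_fun_commute_add_diff: "comp_fun_commute add_diff"
  by unfold_locales (auto simp: fun_eq_iff add_diff_def add_mset_commute)

lemma iter_diff_empty [simp]: "iter_diff F {#} = F"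
  by (simp add: iter_diff_def)

lemma iter_diff_add_mset:
  "iter_diff F (add_mset z W) M = iter_diff F W (add_mset z M) - iter_diff F W M"
  by (simp add: iter_diff_def comp_fun_commute.fold_mset_add_mset[OF comp_fun_commute_add_diff]
      add_diff_def)

text \<open>Take the difference along \<open>z\<close> last: the other differences preserve
  invariance under adding \<open>z\<close>.\<close>

lemma iter_diff_eq_0:
  assumes "\<And>M. F (add_mset z M) = F M" "z \<in># W"
  shows "iter_diff F W M = 0"
proof -
  obtain W' where W: "W = add_mset z W'"
    using assms(2) by (metis mset_add)
  have "iter_diff F W' (add_mset z M) = iter_diff F W' M" for M
  proof (induction W' arbitrary: M)
    case empty
    then show ?case by (simp add: assms(1))
  next
    case (add w W')
    then show ?case
      using add[of "add_mset w M"] by (simp add: iter_diff_add_mset add_mset_commute[of w z])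
  qed
  then show ?thesis
    by (simp add: W iter_diff_add_mset)
qed

text \<open>Adding a point is the identity plus a difference operator; expanding the product of
  these commuting operators gives one term per subset. The base \<open>M\<close> varies, since the
  induction step is applied at \<open>M\<close> enlarged by the new point.\<close>

lemma newton_expansion:
  assumes "finite A"
  shows "F (image_mset x (mset_set A) + M) =
    (\<Sum>S\<in>Pow A. iter_diff F (image_mset x (mset_set S)) M)"
  using assms
proof (induction A arbitrary: M rule: finite_induct)
  case empty
  then show ?case by simp
next
  case (insert a A)
  let ?D = "\<lambda>S. iter_diff F (image_mset x (mset_set S))"
  have "(\<Sum>S\<in>Pow (insert a A). ?D S M) = (\<Sum>S\<in>Pow A. ?D S M) + (\<Sum>S\<in>insert a ` Pow A. ?D S M)"
    unfolding Pow_insert using insert.hyps by (intro sum.union_disjoint) auto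
  also have "(\<Sum>S\<in>insert a ` Pow A. ?D S M) = (\<Sum>S\<in>Pow A. ?D (insert a S) M)"
    using insert.hyps by (subst sum.reindex) (auto simp: inj_on_def)
  also have "\<dots> = (\<Sum>S\<in>Pow A. ?D S (add_mset (x a) M) - ?D S M)"
  proof (intro sum.cong refl)
    fix S assume "S \<in> Pow A"
    then have "finite S" "a \<notin> S"
      using insert.hyps finite_subset by auto
    then show "?D (insert a S) M = ?D S (add_mset (x a) M) - ?D S M"
      by (simp add: iter_diff_add_mset)
  qed
  finally show ?case
    using insert.IH[of "add_mset (x a) M"] insert.hyps by (simp add: sum_subtractf)
qed

section \<open>Generation\<close>

text \<open>The differences of a family become polynomials in the coordinates
  \<open>\<eta> = y - x\<close> (flag \<open>True\<close>) and \<open>\<xi> = y + x\<close> (flag \<open>False\<close>).\<close>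

definition eta_xi_pair :: "(var \<Rightarrow> real) \<Rightarrow> nat \<Rightarrow> pair" where
  "eta_xi_pair pt i = (\<lambda>j. (pt (i, j, False) - pt (i, j, True)) / 2,
                       \<lambda>j. (pt (i, j, False) + pt (i, j, True)) / 2)"

definition eta_xi_point :: "pair list \<Rightarrow> var \<Rightarrow> real" where
  "eta_xi_point W = (\<lambda>(i, j, s). if s then snd (W ! (i - 1)) j - fst (W ! (i - 1)) j
                                 else snd (W ! (i - 1)) j + fst (W ! (i - 1)) j)"

lemma eta_xi_pair_point: "eta_xi_pair (eta_xi_point W) (Suc l) = W ! l"
  by (simp add: eta_xi_pair_def eta_xi_point_def field_simps)

lemma mset_eta_xi_pair_point:
  "image_mset (eta_xi_pair (eta_xi_point W)) (mset_set {1..length W}) = mset W"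
proof -
  have "map (eta_xi_pair (eta_xi_point W)) [1..<Suc (length W)] = W"
    by (rule nth_equalityI) (auto simp: eta_xi_pair_point simp del: upt_Suc)
  then have "mset W = image_mset (eta_xi_pair (eta_xi_point W)) (mset [1..<Suc (length W)])"
    by (metis mset_map)
  then show ?thesis
    by (simp add: atLeastLessThanSuc_atLeastAtMost del: upt_Suc)
qed

text \<open>The old coordinates are linear in \<eta> and \<xi>, so the degree bound carries over.
  \<open>J\<close> selects which of the \<open>k\<close> generic points are inserted.\<close>

lemma polyfun_phi:
  assumes "f \<in> Afin n" "\<And>m \<mu>. \<mu> \<in> keys (f m) \<Longrightarrow> mdeg \<mu> \<le> d" "set J \<subseteq> {1..k}"
  shows "polyfun (block_vars n k) d (\<lambda>pt. phi (map (eta_xi_pair pt) J) f)"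
  unfolding phi_def
proof (simp, rule polyfun_compose_linear)
  fix v assume "v \<in> mvars (f (length J))"
  then have "v \<in> block_vars n (length J)"
    using Afin_Aring[OF assms(1), of "length J"] by (auto simp: Aring_iff Pring_iff)
  then obtain i j s where v: "v = (i, j, s)" "1 \<le> i" "i \<le> length J" "j \<in> {1..n}"
    by (auto simp: block_vars_def)
  then have "J ! (i - 1) \<in> set J"
    by (intro nth_mem) auto
  then have "J ! (i - 1) \<in> {1..k}"
    using assms(3) by blast
  then have var: "polyfun (block_vars n k) 1 (\<lambda>pt. pt (J ! (i - 1), j, t))" for t
    using v(4) by (intro polyfun_var) (auto simp: block_vars_def)
  have eq: "(\<lambda>pt. point (map (eta_xi_pair pt) J) v) =
    (\<lambda>pt. (1 / 2) * (if s then pt (J ! (i - 1), j, False) + pt (J ! (i - 1), j, True)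
                   else pt (J ! (i - 1), j, False) - pt (J ! (i - 1), j, True)))"
    using v by (auto simp: point_def eta_xi_pair_def)
  show "polyfun (block_vars n k) 1 (\<lambda>pt. point (map (eta_xi_pair pt) J) v)"
    unfolding eq
    by (rule polyfun_cmult) (cases s; simp only: if_True if_False; intro polyfun_add polyfun_diff var)
qed (use assms(2) in auto)

text \<open>Unfolding the differences leaves values of \<open>F\<close> on multisets of the given
  points; \<open>N\<close> collects the points already added.\<close>

lemma polyfun_iter_diff:
  assumes "\<And>J. set J \<subseteq> {1..k} \<Longrightarrow> polyfun V d (\<lambda>pt. F (mset (map (x pt) J)))"
    and "finite A" "A \<subseteq> {1..k}" "set_mset N \<subseteq> {1..k}"
  shows "polyfun V d (\<lambda>pt. iter_diff F (image_mset (x pt) (mset_set A)) (image_mset (x pt) N))"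
  using assms(2-)
proof (induction A arbitrary: N rule: finite_induct)
  case empty
  obtain J where "mset J = N"
    using ex_mset by blast
  then show ?case
    using assms(1)[of J] empty by auto
next
  case (insert a A)
  then have "polyfun V d (\<lambda>pt. iter_diff F (image_mset (x pt) (mset_set A)) (image_mset (x pt) (add_mset a N))
      - iter_diff F (image_mset (x pt) (mset_set A)) (image_mset (x pt) N))"
    by (intro polyfun_diff insert.IH) auto
  then show ?case
    using insert.hyps by (simp add: iter_diff_add_mset)
qed

lemma monom_eval_eta_xi_point:
  assumes "keys \<mu> \<subseteq> block_vars n k"
  shows "monom_eval \<mu> (eta_xi_point W) = (\<Prod>l<k. pair_monom n
    (map (\<lambda>j. lookup \<mu> (Suc l, Suc j, True)) [0..<n], map (\<lambda>j. lookup \<mu> (Suc l, Suc j, False)) [0..<n])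
    (W ! l))"
proof -
  let ?t = "\<lambda>v. eta_xi_point W v ^ lookup \<mu> v"
  have "monom_eval \<mu> (eta_xi_point W) = (\<Prod>v\<in>block_vars n k. ?t v)"
    using assms by (intro monom_eval_superset) (auto simp: block_vars_def)
  also have "\<dots> = (\<Prod>i\<in>{1..k}. \<Prod>j\<in>{1..n}. \<Prod>s\<in>UNIV. ?t (i, j, s))"
    unfolding block_vars_def prod.cartesian_product by (rule prod.cong) auto
  also have "\<dots> = (\<Prod>l<k. \<Prod>j\<in>{1..n}. ?t (Suc l, j, True) * ?t (Suc l, j, False))"
    by (simp add: prod.atLeast1_atMost_eq UNIV_bool mult.commute)
  finally show ?thesis
    by (simp add: pair_monom_def prod.atLeast1_atMost_eq eta_xi_point_def)
qed

lemma Asp_in_psum_algebra: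
  assumes "1 \<le> n" "f \<in> Asp n"
  shows "(\<lambda>X. phi X f) \<in> psum_algebra n"
proof -
  have f: "f \<in> Afin n" "\<And>X z. degenerate n z \<Longrightarrow> phi (X @ [z]) f = phi X f"
    using assms(2) by (auto simp: Asp_def)
  obtain d where d: "\<And>m \<mu>. \<mu> \<in> keys (f m) \<Longrightarrow> mdeg \<mu> \<le> d"
    using Afin_bounded_degree[OF f(1)] by blast
  \<comment> \<open>The choice of a list is harmless because \<open>phi\<close> depends only on the
    multiset.\<close>
  define F where "F M = phi (SOME X. mset X = M) f" for M
  have F: "F (mset X) = phi X f" for X
    unfolding F_def by (rule phi_mset[OF f(1)]) (rule someI, rule refl)
  have F_degenerate: "F (add_mset z M) = F M" if "degenerate n z" for z M
  proof -
    obtain X where "mset X = M"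
      using ex_mset by blast
    then show ?thesis
      using F[of "X @ [z]"] F[of X] f(2)[OF that, of X] by simp
  qed
  have polyfun_F: "polyfun (block_vars n k) d (\<lambda>pt. F (mset (map (eta_xi_pair pt) J)))"
    if "set J \<subseteq> {1..k}" for J k
    unfolding F using f(1) d that by (rule polyfun_phi)
  \<comment> \<open>The difference along \<open>k\<close> generic points, based at the empty
    multiset, is a polynomial whose degree bound \<open>d\<close> does not depend on
    \<open>k\<close>.\<close>
  have "polyfun (block_vars n k) d (\<lambda>pt. iter_diff F (image_mset (eta_xi_pair pt) (mset_set {1..k}))
      (image_mset (eta_xi_pair pt) {#}))" for k
    by (rule polyfun_iter_diff[OF polyfun_F]) auto
  then have "\<exists>P. mvars P \<subseteq> block_vars n k \<and> (\<forall>\<mu>\<in>keys P. mdeg \<mu> \<le> d) \<and>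
      (\<forall>pt. iter_diff F (image_mset (eta_xi_pair pt) (mset_set {1..k})) {#} = meval P pt)" for k
    by (simp add: polyfun_def)
  then obtain P where P: "\<And>k. mvars (P k) \<subseteq> block_vars n k" "\<And>k \<mu>. \<mu> \<in> keys (P k) \<Longrightarrow> mdeg \<mu> \<le> d"
    "\<And>k pt. iter_diff F (image_mset (eta_xi_pair pt) (mset_set {1..k})) {#} = meval (P k) pt"
    by metis
  \<comment> \<open>If \<eta>_ij = 0, the \<open>i\<close>-th point is degenerate and the difference
    along it vanishes; hence every monomial contains \<eta>_ij.\<close>
  have full: "(i, j, True) \<in> keys \<mu>" if "\<mu> \<in> keys (P k)" "i \<in> {1..k}" "j \<in> {1..n}" for k \<mu> i j
  proof (rule keys_contain_var[OF _ that(1)])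
    fix pt :: "var \<Rightarrow> real" assume "pt (i, j, True) = 0"
    then have "degenerate n (eta_xi_pair pt i)"
      using that(3) by (auto simp: degenerate_def eta_xi_pair_def)
    then show "meval (P k) pt = 0"
      unfolding P(3)[symmetric] using F_degenerate that(2)
      by (intro iter_diff_eq_0[of F "eta_xi_pair pt i"]) auto
  qed
  \<comment> \<open>The exponents of \<mu> in block \<open>l + 1\<close>, read as a generator index;
    by \<open>full\<close> the first list is positive. The shifts convert positions from 0 into
    blocks and coordinates from 1.\<close>
  define c where "c \<mu> l = (map (\<lambda>j. lookup \<mu> (Suc l, Suc j, True)) [0..<n],
    map (\<lambda>j. lookup \<mu> (Suc l, Suc j, False)) [0..<n])" for \<mu> :: "var \<Rightarrow>\<^sub>0 nat" and l
  define \<phi>s where "\<phi>s k \<mu> = map (\<lambda>l. pair_monom n (c \<mu> l)) [0..<k]" for k \<mu>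
  have gen: "set (\<phi>s k \<mu>) \<subseteq> pair_monom n ` gen_index n" if "\<mu> \<in> keys (P k)" for k \<mu>
    using full[OF that] by (auto simp: \<phi>s_def c_def gen_index_def in_keys_iff)
  have diff: "iter_diff F (mset W) {#} =
      (\<Sum>\<mu>\<in>keys (P k). lookup (P k) \<mu> * (\<Prod>l<k. (\<phi>s k \<mu> ! l) (W ! l)))" if "length W = k" for W k
  proof -
    have "iter_diff F (mset W) {#} = meval (P k) (eta_xi_point W)"
      using mset_eta_xi_pair_point[of W] P(3)[of "eta_xi_point W" k] that by simp
    moreover have "monom_eval \<mu> (eta_xi_point W) = (\<Prod>l<k. (\<phi>s k \<mu> ! l) (W ! l))"
      if "\<mu> \<in> keys (P k)" for \<mu>
    proof -
      have "keys \<mu> \<subseteq> block_vars n k"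
        using P(1)[of k] that by (auto simp: mvars_def)
      then show ?thesis
        by (simp add: monom_eval_eta_xi_point \<phi>s_def c_def)
    qed
    ultimately show ?thesis
      by (simp add: meval_eq)
  qed
  \<comment> \<open>Each of the \<open>k\<close> blocks contributes its variable \<eta>_i1 to every
    monomial, so the degree is at least \<open>k\<close>.\<close>
  have P_0: "keys (P k) = {}" if "d < k" for k
  proof (rule ccontr)
    assume "keys (P k) \<noteq> {}"
    then obtain \<mu> where \<mu>: "\<mu> \<in> keys (P k)" by blast
    have "k = card ((\<lambda>i. (i, 1 :: nat, True)) ` {1..k})"
      by (subst card_image) (auto simp: inj_on_def)
    also have "\<dots> \<le> card (keys \<mu>)"
      using full[OF \<mu>] assms(1) by (intro card_mono) auto
    also have "\<dots> \<le> d"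
      using card_keys_le_mdeg P(2)[OF \<mu>] by (rule order_trans)
    finally show False using that by simp
  qed
  have "phi X f = (\<Sum>k\<le>d. (1 / fact k) * (\<Sum>\<mu>\<in>keys (P k). lookup (P k) \<mu> * distinct_sum (\<phi>s k \<mu>) X))" for X
  proof -
    let ?m = "length X"
    let ?D = "\<lambda>S. iter_diff F (image_mset ((!) X) (mset_set S)) {#}"
    \<comment> \<open>The difference depends only on the set of indices, while the right side uses
      the chosen order; both agree for every ordering \<open>I\<close>.\<close>
    have D: "?D (set I) = (\<Sum>\<mu>\<in>keys (P k). lookup (P k) \<mu> * (\<Prod>l<k. (\<phi>s k \<mu> ! l) (X ! (I ! l))))"
      if "I \<in> distinct_lists ?m k" for I k
    proof -
      have I: "distinct I" "length I = k"
        using that by (auto simp: distinct_lists_def)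
      then show ?thesis
        using diff[of "map ((!) X) I" k] by (simp add: mset_set_set cong: prod.cong_simp)
    qed
    have "mset X = image_mset ((!) X) (mset_set {..<?m})"
      using map_nth[of X] by (metis lessThan_atLeast0 mset_map mset_upt)
    then have "phi X f = (\<Sum>S\<in>Pow {..<?m}. ?D S)"
      using newton_expansion[of "{..<?m}" F "(!) X" "{#}"] F[of X] by simp
    also have "\<dots> = (\<Sum>S\<in>{S \<in> Pow {..<?m}. card S \<le> d}. ?D S)"
    proof (rule sum.mono_neutral_right)
      show "\<forall>S\<in>Pow {..<?m} - {S \<in> Pow {..<?m}. card S \<le> d}. ?D S = 0"
      proof
        fix S assume S: "S \<in> Pow {..<?m} - {S \<in> Pow {..<?m}. card S \<le> d}"
        then have "finite S"
          using finite_subset by blast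
        \<comment> \<open>Any enumeration of \<open>S\<close> would serve here; \<open>D\<close>
          then rewrites the difference as a sum over the empty set of monomials.\<close>
        then have "sorted_list_of_set S \<in> distinct_lists ?m (card S)"
          using S by (auto simp: distinct_lists_def)
        from D[OF this] show "?D S = 0"
          using P_0[of "card S"] S \<open>finite S\<close> by auto
      qed
    qed auto
    also have "\<dots> = (\<Sum>k\<le>d. \<Sum>S\<in>{S \<in> {S \<in> Pow {..<?m}. card S \<le> d}. card S = k}. ?D S)"
      by (rule sum.group[symmetric]) auto
    also have "\<dots> = (\<Sum>k\<le>d. (1 / fact k) * (\<Sum>\<mu>\<in>keys (P k). lookup (P k) \<mu> * distinct_sum (\<phi>s k \<mu>) X))"
    proof (intro sum.cong refl)
      fix k assume k: "k \<in> {..d}"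
      have "{S \<in> {S \<in> Pow {..<?m}. card S \<le> d}. card S = k} = {S. S \<subseteq> {..<?m} \<and> card S = k}"
        using k by auto
      then have "(\<Sum>S\<in>{S \<in> {S \<in> Pow {..<?m}. card S \<le> d}. card S = k}. ?D S)
          = (1 / fact k) * (\<Sum>I\<in>distinct_lists ?m k. ?D (set I))"
        using sum_distinct_lists_set[of ?D ?m k] by simp
      also have "(\<Sum>I\<in>distinct_lists ?m k. ?D (set I)) =
          (\<Sum>I\<in>distinct_lists ?m k. \<Sum>\<mu>\<in>keys (P k). lookup (P k) \<mu> * (\<Prod>l<k. (\<phi>s k \<mu> ! l) (X ! (I ! l))))"
        by (intro sum.cong refl D)
      also have "\<dots> = (\<Sum>\<mu>\<in>keys (P k). lookup (P k) \<mu> * distinct_sum (\<phi>s k \<mu>) X)"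
        by (subst sum.swap) (simp add: distinct_sum_def sum_distrib_left \<phi>s_def)
      finally show "(\<Sum>S\<in>{S \<in> {S \<in> Pow {..<?m}. card S \<le> d}. card S = k}. ?D S)
          = (1 / fact k) * (\<Sum>\<mu>\<in>keys (P k). lookup (P k) \<mu> * distinct_sum (\<phi>s k \<mu>) X)" .
    qed
    finally show ?thesis .
  qed
  moreover have "(\<lambda>X. \<Sum>k\<le>d. (1 / fact k) *
      (\<Sum>\<mu>\<in>keys (P k). lookup (P k) \<mu> * distinct_sum (\<phi>s k \<mu>) X)) \<in> psum_algebra n"
    by (intro psum_algebra_sum psum_algebra_cmult distinct_sum_psum_algebra gen)
  ultimately show ?thesis
    by (simp only:)
qed

text \<open>\<open>gen_eval\<close> substitutes the generators into a polynomial. Injectivity is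
  their algebraic independence, and the image being \<open>Asp n\<close> says that they lie in this
  ring and generate it.\<close>

theorem theorem2p7:
  fixes n :: nat
  assumes "1 \<le> n"
  shows "bij_betw (gen_eval n) {Q. mvars Q \<subseteq> gen_index n} (Asp n)"
  unfolding bij_betw_def
proof (intro conjI inj_on_gen_eval equalityI subsetI)
  fix f assume f: "f \<in> Asp n"
  obtain Q where Q: "mvars Q \<subseteq> gen_index n" "\<And>X. phi X f = meval Q (psum n X)"
    using Asp_in_psum_algebra[OF assms f] by (auto simp: psum_algebra_def)
  have "f = gen_eval n Q"
  proof (rule family_eqI)
    show "f m \<in> Pring n m" for m
      using f Afin_Aring[of f n m] by (auto simp: Asp_def Aring_iff)
    show "gen_eval n Q m \<in> Pring n m" for m
      by (rule gen_eval_Pring)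
    show "phi X f = phi X (gen_eval n Q)" for X
      by (simp add: Q(2) phi_gen_eval)
  qed
  then show "f \<in> gen_eval n ` {Q. mvars Q \<subseteq> gen_index n}"
    using Q(1) by blast
qed (use gen_eval_Asp[OF assms] in auto)

end
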